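(* Let $(T_i)_{i\in I}$ be an admissible family of deformations on a domain $\Omega\subset\mathbb{R}^n$, and let $\mu\in\mathcal{P}_2(\Omega)$ be absolutely continuous with respect to Lebesgue measure. Let $T_1,\dots,T_J$ be members of this family, let $\mu_j=(T_j)_\#\mu$ for $1\le j\le J$, assume $\mu_j\in\mathcal{P}_2(\Omega)$ for all $j$, and let $\lambda_1,\dots,\lambda_J>0$ with $\sum_{j=1}^J\lambda_j=1$. Then $$\mathrm{IB}\big((\mu_j,\lambda_j)_{1\le j\le J}\big)=\Big(\sum_{j=1}^J\lambda_jT_j\Big)_\#\mu .$$ Moreover $$\mathrm{IB}\big((\mu_j,\lambda_j)_{1\le j\le J}\big)=\mathrm{Bar}\big((\mu_j,\lambda_j)_{1\le j\le J}\big).$$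
   Context: $\mathcal{P}_2(E)$ is the set of Borel probability measures on $E$ with finite second moment; measures on $\Omega\subset\mathbb{R}^n$ are regarded as measures on $\mathbb{R}^n$. $T_\#\mu$ is the push-forward, $T_\#\mu(A)=\mu(T^{-1}(A))$. $W_2$ is the 2-Wasserstein distance: $W_2^2(\mu,\nu)$ is the infimum of $\int|x-y|^2d\pi$ over couplings $\pi$ of $\mu$ and $\nu$. Barycenter: for $\nu_1,\dots,\nu_J\in\mathcal{P}_2(\mathbb{R}^n)$ and nonnegative weights $\lambda_j$ summing to $1$, $\mathrm{Bar}((\nu_j,\lambda_j)_{1\le j\le J})$ denotes the minimizer over $\nu\in\mathcal{P}_2(\mathbb{R}^n)$ of $\sum_{j}\lambda_jW_2^2(\nu,\nu_j)$. For positive weights not summing to $1$ the same minimization problem is used (equivalently, the weights are normalized). Iterated barycenter: $\mathrm{IB}((\mu_1,\lambda_1))=\mu_1$ and, recursively, $\mathrm{IB}((\mu_i,\lambda_i)_{1\le i\le k})$ is the barycenter of the two weighted measures $\big(\mathrm{IB}((\mu_i,\lambda_i)_{1\le i\le k-1}),\ \lambda_1+\dots+\lambda_{k-1}\big)$ and $(\mu_k,\lambda_k)$. $GCF(\Omega)$ is the set of gradients of convex functions on $\Omega$: maps $T:\Omega\to\mathbb{R}^n$ for which there is a proper convex lower semi-continuous function $\phi$ with $T=\nabla\phi$ on $\Omega$; here $\phi$ is understood as a convex function on $\mathbb{R}^n$ with values in $(-\infty,+\infty]$ that is finite and differentiable on $\Omega$. A family $(T_i)_{i\in I}$ of maps on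 $\Omega$ is an admissible family of deformations if: (1) there is $i_0\in I$ with $T_{i_0}=\mathrm{Id}$; (2) each $T_i:\Omega\to\Omega$ is one-to-one and onto; (3) $T_i\circ T_j^{-1}\in GCF(\Omega)$ for all $i,j\in I$. *)

theory Defs
  imports "HOL-Probability.Probability"
begin

text \<open>Measures on \<open>\<Omega>\<close> are represented by Borel measures on the whole space that are
  concentrated on \<open>\<Omega>\<close>.\<close>

definition P2 :: "'a::euclidean_space set \<Rightarrow> 'a measure set" where
  "P2 \<Omega> = {\<mu>. prob_space \<mu> \<and> sets \<mu> = sets borel \<and> (AE x in \<mu>. x \<in> \<Omega>) \<and>
                integrable \<mu> (\<lambda>x. (norm x)\<^sup>2)}"

text \<open>Only the values of \<open>T\<close> on \<open>\<Omega>\<close> matter: the result maps a Borel set \<open>A\<close> to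
  \<open>\<mu> {x \<in> \<Omega>. T x \<in> A}\<close>. Hence \<open>T\<close> need not be measurable outside \<open>\<Omega>\<close>.\<close>

definition push_forward :: "'a::euclidean_space set \<Rightarrow> ('a \<Rightarrow> 'a) \<Rightarrow> 'a measure \<Rightarrow> 'a measure" where
  "push_forward \<Omega> T \<mu> = distr (restrict_space \<mu> \<Omega>) borel T"

definition couplings :: "'a::euclidean_space measure \<Rightarrow> 'a measure \<Rightarrow> ('a \<times> 'a) measure set" where
  "couplings \<mu> \<nu> = {\<pi>. sets \<pi> = sets (borel \<Otimes>\<^sub>M borel) \<and>
                       distr \<pi> borel fst = \<mu> \<and> distr \<pi> borel snd = \<nu>}"

text \<open>The infimum is finite for measures with finite second moment, the only ones for which
  this definition is meant; \<open>enn2real\<close> then loses nothing.\<close>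

definition W2 :: "'a::euclidean_space measure \<Rightarrow> 'a measure \<Rightarrow> real" where
  "W2 \<mu> \<nu> = sqrt (enn2real
     (INF \<pi>\<in>couplings \<mu> \<nu>. \<integral>\<^sup>+ z. ennreal ((dist (fst z) (snd z))\<^sup>2) \<partial>\<pi>))"

text \<open>A list of pairs \<open>(\<nu>\<^sub>j, \<lambda>\<^sub>j)\<close> represents a family of weighted measures. The weights are
  not required to sum to one.\<close>

definition is_barycenter ::
  "('a::euclidean_space measure \<times> real) list \<Rightarrow> 'a measure \<Rightarrow> bool" where
  "is_barycenter xs \<nu> \<longleftrightarrow> \<nu> \<in> P2 UNIV \<and>
     (\<forall>\<nu>'\<in>P2 UNIV. (\<Sum>(m, w)\<leftarrow>xs. w * (W2 \<nu> m)\<^sup>2) \<le> (\<Sum>(m, w)\<leftarrow>xs. w * (W2 \<nu>' m)\<^sup>2))"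

definition Bar :: "('a::euclidean_space measure \<times> real) list \<Rightarrow> 'a measure" where
  "Bar xs = (THE \<nu>. is_barycenter xs \<nu>)"

fun IB :: "('a::euclidean_space measure \<times> real) list \<Rightarrow> 'a measure" where
  "IB xs = (if length xs \<le> 1 then fst (hd xs)
            else Bar [(IB (butlast xs), \<Sum>(m, w)\<leftarrow>butlast xs. w), last xs])"

declare IB.simps [simp del]

lemma IB_single: "IB [(m, w)] = m"
  by (simp add: IB.simps)

lemma IB_snoc:
  "xs \<noteq> [] \<Longrightarrow> IB (xs @ [(m, w)]) = Bar [(IB xs, \<Sum>(m', w')\<leftarrow>xs. w'), (m, w)]"
  by (subst IB.simps) (cases xs; simp)

definition weighted_family ::
  "(nat \<Rightarrow> 'a measure) \<Rightarrow> (nat \<Rightarrow> real) \<Rightarrow> nat \<Rightarrow> ('a measure \<times> real) list" where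
  "weighted_family m w k = map (\<lambda>j. (m j, w j)) [1..<Suc k]"

text \<open>The clauses express properness, convexity and lower semicontinuity. In the convexity
  clause the right-hand side is well defined because \<open>\<phi>\<close> never takes the value \<open>-\<infinity>\<close>.\<close>

definition proper_convex_lsc :: "('a::euclidean_space \<Rightarrow> ereal) \<Rightarrow> bool" where
  "proper_convex_lsc \<phi> \<longleftrightarrow>
     (\<forall>x. \<phi> x \<noteq> -\<infinity>) \<and> (\<exists>x. \<phi> x \<noteq> \<infinity>) \<and>
     (\<forall>x y t. 0 < t \<and> t < 1 \<longrightarrow>
        \<phi> ((1 - t) *\<^sub>R x + t *\<^sub>R y) \<le> ereal (1 - t) * \<phi> x + ereal t * \<phi> y) \<and>
     (\<forall>x. \<phi> x \<le> Liminf (at x) \<phi>)"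

text \<open>For open \<open>\<Omega>\<close>, finiteness on \<open>\<Omega>\<close> makes \<open>real_of_ereal \<circ> \<phi>\<close> agree with \<open>\<phi>\<close> near each
  point of \<open>\<Omega>\<close>, so its gradient there is that of \<open>\<phi>\<close>.\<close>

definition GCF :: "'a::euclidean_space set \<Rightarrow> ('a \<Rightarrow> 'a) set" where
  "GCF \<Omega> = {T. \<exists>\<phi>. proper_convex_lsc \<phi> \<and>
     (\<forall>x\<in>\<Omega>. \<bar>\<phi> x\<bar> \<noteq> \<infinity> \<and> (GDERIV (\<lambda>y. real_of_ereal (\<phi> y)) x :> T x))}"

definition admissible_family ::
  "'a::euclidean_space set \<Rightarrow> 'i set \<Rightarrow> ('i \<Rightarrow> 'a \<Rightarrow> 'a) \<Rightarrow> bool" where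
  "admissible_family \<Omega> I T \<longleftrightarrow>
     (\<exists>i0\<in>I. \<forall>x\<in>\<Omega>. T i0 x = x) \<and>
     (\<forall>i\<in>I. bij_betw (T i) \<Omega> \<Omega>) \<and>
     (\<forall>i\<in>I. \<forall>j\<in>I. T i \<circ> inv_into \<Omega> (T j) \<in> GCF \<Omega>)"

end

theory Submission
  imports Defs
begin

text \<open>Everything happens on \<open>\<Omega>\<close> with the measure \<open>\<mu>\<close>: the \<open>\<mu>\<^sub>j\<close> are the laws of the maps
  \<open>X\<^sub>j = T\<^sub>j\<close>, and admissibility says that \<open>X\<^sub>i = \<nabla>\<phi>\<^sub>i\<^sub>j \<circ> X\<^sub>j\<close> with \<open>\<phi>\<^sub>i\<^sub>j\<close> convex.
  Expanding \<open>|\<Sum> w\<^sub>j x\<^sub>j|\<^sup>2\<close> and bounding each product \<open>x\<^sub>i \<bullet> x\<^sub>j\<close> by Fenchel's inequality for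
  \<open>\<phi>\<^sub>i\<^sub>j\<close> yields functions \<open>G\<^sub>j\<close> such that \<open>\<Sum> w\<^sub>j G\<^sub>j(a\<^sub>j) \<le> \<Sum> w\<^sub>j |y - X\<^sub>j(a\<^sub>j)|\<^sup>2\<close> for all
  points \<open>y\<close> and \<open>a\<^sub>j\<close>, with equality when all \<open>a\<^sub>j\<close> equal some \<open>b\<close> and \<open>y = S(b) = \<Sum> w\<^sub>j X\<^sub>j(b)\<close>.
  The functions \<open>h\<^sub>j(y) = inf\<^sub>a |y - X\<^sub>j(a)|\<^sup>2 - G\<^sub>j(a)\<close> then satisfy \<open>\<Sum> w\<^sub>j h\<^sub>j \<ge> 0\<close>, and
  the pairs \<open>(h\<^sub>j, G\<^sub>j)\<close> certify through the easy half of Kantorovich duality that \<open>S\<^sub>#\<mu>\<close> is a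
  barycenter. It is the only one because \<open>G\<^sub>n\<close> is built from potentials that are differentiable
  at \<open>X\<^sub>n(b)\<close>, which forces mass transported to \<open>X\<^sub>n(b)\<close> to come from \<open>S(b)\<close>.

  A weighted mean of the \<open>T\<^sub>i\<close> is again the gradient of a convex function along
  \<open>T\<^sub>k\<^sub>+\<^sub>1\<close>, so the same result applies to each two-measure step of the iterated barycenter, although
  the mean need not map \<open>\<Omega>\<close> into \<open>\<Omega>\<close>.\<close>

section \<open>Measures and Wasserstein bounds\<close>

text \<open>A one-sided inequality suffices because it can also be applied to \<open>1 - f\<close>.
  Indicators of closed sets are limits of such \<open>f\<close>, and closed sets form an
  intersection-stable generator.\<close>

lemma borel_measure_eqI_continuous:
  fixes \<mu> \<nu> :: "'a::metric_space measure"
  assumes "prob_space \<mu>" "prob_space \<nu>"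
    and sets: "sets \<mu> = sets borel" "sets \<nu> = sets borel"
    and le: "\<And>f :: 'a \<Rightarrow> real. continuous_on UNIV f \<Longrightarrow> (\<And>x. 0 \<le> f x) \<Longrightarrow> (\<And>x. f x \<le> 1) \<Longrightarrow>
      integral\<^sup>L \<mu> f \<le> integral\<^sup>L \<nu> f"
  shows "\<mu> = \<nu>"
proof -
  interpret \<mu>: prob_space \<mu> by fact
  interpret \<nu>: prob_space \<nu> by fact
  have int: "integrable \<rho> f" if "sets \<rho> = sets borel" "prob_space \<rho>" "continuous_on UNIV f"
    "\<And>x. 0 \<le> f x" "\<And>x. f x \<le> 1" for \<rho> :: "'a measure" and f :: "'a \<Rightarrow> real"
  proof -
    interpret prob_space \<rho> by fact
    have "f \<in> borel_measurable \<rho>"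
      using that(1,3) by (simp add: borel_measurable_continuous_onI cong: measurable_cong_sets)
    then show ?thesis
      by (rule integrable_const_bound[rotated, where B=1]) (use that in auto)
  qed
  have eq: "integral\<^sup>L \<mu> f = integral\<^sup>L \<nu> f"
    if f: "continuous_on UNIV f" "\<And>x. 0 \<le> f x" "\<And>x. f x \<le> 1" for f :: "'a \<Rightarrow> real"
  proof (rule antisym)
    show "integral\<^sup>L \<mu> f \<le> integral\<^sup>L \<nu> f" using le f by blast
    have "(\<integral>x. 1 - f x \<partial>\<mu>) \<le> (\<integral>x. 1 - f x \<partial>\<nu>)"
      using f by (intro le continuous_intros) auto
    then show "integral\<^sup>L \<nu> f \<le> integral\<^sup>L \<mu> f"
      using int[OF sets(1) \<open>prob_space \<mu>\<close> f] int[OF sets(2) \<open>prob_space \<nu>\<close> f]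
      by (simp add: \<mu>.prob_space \<nu>.prob_space)
  qed
  have meas_closed: "measure \<mu> C = measure \<nu> C" if "closed C" for C
  proof (cases "C = {}")
    case False
    \<comment> \<open>Continuous approximations of the indicator of \<open>C\<close>. The empty set
      is split off because \<open>infdist\<close> to it is 0 by convention.\<close>
    define f where "f k x = max 0 (1 - real k * infdist x C)" for k x
    have f: "continuous_on UNIV (f k)" "0 \<le> f k x" "f k x \<le> 1" for k x
      unfolding f_def by (auto intro!: continuous_intros simp: infdist_nonneg)
    have lim: "(\<lambda>k. f k x) \<longlonglongrightarrow> indicator C x" for x
    proof (cases "x \<in> C")
      case True
      then show ?thesis by (simp add: f_def)
    next
      case nC: False
      then have pos: "infdist x C > 0"
        using that False by (metis in_closed_iff_infdist_zero infdist_nonneg less_eq_real_def)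
      have "eventually (\<lambda>k. f k x = 0) sequentially"
      proof -
        obtain N :: nat where N: "1 / infdist x C < N" using reals_Archimedean2 by blast
        have "f k x = 0" if "k \<ge> N" for k
        proof -
          have "1 / infdist x C < real k" using N that by linarith
          then have "1 < real k * infdist x C" using pos by (simp add: field_simps)
          then show ?thesis by (simp add: f_def)
        qed
        then show ?thesis using eventually_sequentially by blast
      qed
      then show ?thesis using nC by (simp add: tendsto_eventually)
    qed
    have conv: "(\<lambda>k. integral\<^sup>L \<rho> (f k)) \<longlonglongrightarrow> measure \<rho> C"
      if \<rho>: "sets \<rho> = sets borel" "prob_space \<rho>" for \<rho>
    proof -
      interpret prob_space \<rho> by fact
      have "(\<lambda>k. integral\<^sup>L \<rho> (f k)) \<longlonglongrightarrow> (\<integral>x. indicator C x \<partial>\<rho>)"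
      proof (rule integral_dominated_convergence[where w="\<lambda>_. 1"])
        show "indicator C \<in> borel_measurable \<rho>" by (rule borel_measurable_indicator) (use \<open>closed C\<close> \<rho>(1) in auto)
        show "f k \<in> borel_measurable \<rho>" for k
          using int[OF \<rho> f(1-3)] by auto
      qed (use lim f in auto)
      also have "(\<integral>x. indicator C x \<partial>\<rho>) = measure \<rho> C"
        using sets_eq_imp_space_eq[OF \<rho>(1)] by simp
      finally show ?thesis .
    qed
    have "(\<lambda>k. integral\<^sup>L \<mu> (f k)) = (\<lambda>k. integral\<^sup>L \<nu> (f k))"
      using eq[OF f] by blast
    then show ?thesis
      using conv[OF sets(1) \<open>prob_space \<mu>\<close>] conv[OF sets(2) \<open>prob_space \<nu>\<close>] LIMSEQ_unique by metis
  qed simp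
  show ?thesis
  proof (rule measure_eqI_generator_eq[where E="Collect closed" and \<Omega>=UNIV and A="\<lambda>_. UNIV"])
    show "sets \<mu> = sigma_sets UNIV (Collect closed)" "sets \<nu> = sigma_sets UNIV (Collect closed)"
      using sets by (simp_all add: borel_eq_closed)
  qed (auto simp: Int_stable_def meas_closed \<mu>.emeasure_eq_measure \<nu>.emeasure_eq_measure)
qed

lemma P2_UNIV_distrI:
  assumes "prob_space M" "X \<in> borel_measurable M" "integrable M (\<lambda>a. (norm (X a))\<^sup>2)"
  shows "distr M borel X \<in> P2 UNIV"
  using assms by (auto simp: P2_def prob_space.prob_space_distr integrable_distr_eq)

lemma integrable_quadratic_bound:
  fixes f :: "'a::euclidean_space \<Rightarrow> real"
  assumes "\<nu> \<in> P2 UNIV" "f \<in> borel_measurable borel" "\<And>y. \<bar>f y\<bar> \<le> A + B * (norm y)\<^sup>2"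
  shows "integrable \<nu> f"
proof -
  interpret prob_space \<nu> using assms(1) by (simp add: P2_def)
  show ?thesis
  proof (rule Bochner_Integration.integrable_bound)
    show "integrable \<nu> (\<lambda>y. A + B * (norm y)\<^sup>2)" using assms(1) by (auto simp: P2_def)
    show "f \<in> borel_measurable \<nu>" using assms(1,2) by (simp add: P2_def cong: measurable_cong_sets)
  qed (auto intro!: AE_I2 order.trans[OF assms(3)])
qed

lemma dist_sq_le: "(dist x y)\<^sup>2 \<le> 2 * (norm x)\<^sup>2 + 2 * (norm y)\<^sup>2"
proof -
  have "(dist x y)\<^sup>2 \<le> (norm x + norm y)\<^sup>2"
    by (simp add: dist_norm norm_triangle_ineq4 power_mono)
  also have "\<dots> \<le> 2 * (norm x)\<^sup>2 + 2 * (norm y)\<^sup>2"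
    using sum_squares_bound[of "norm x" "norm y"] by (simp add: power2_sum)
  finally show ?thesis .
qed

text \<open>The joint law of \<open>X\<close> and \<open>Y\<close> is a coupling of their
  laws.\<close>

lemma W2_le:
  assumes "prob_space M" and [measurable]: "X \<in> borel_measurable M" "Y \<in> borel_measurable M"
    and int: "integrable M (\<lambda>a. (dist (X a) (Y a))\<^sup>2)"
  shows "(W2 (distr M borel X) (distr M borel Y))\<^sup>2 \<le> (\<integral>a. (dist (X a) (Y a))\<^sup>2 \<partial>M)"
proof -
  let ?\<pi> = "distr M (borel \<Otimes>\<^sub>M borel) (\<lambda>a. (X a, Y a))"
  have "?\<pi> \<in> couplings (distr M borel X) (distr M borel Y)"
    by (simp add: couplings_def distr_distr comp_def)
  then have "(INF \<pi>\<in>couplings (distr M borel X) (distr M borel Y).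
        \<integral>\<^sup>+ z. ennreal ((dist (fst z) (snd z))\<^sup>2) \<partial>\<pi>)
      \<le> (\<integral>\<^sup>+ z. ennreal ((dist (fst z) (snd z))\<^sup>2) \<partial>?\<pi>)"
    by (rule INF_lower)
  also have "\<dots> = (\<integral>\<^sup>+ a. ennreal ((dist (X a) (Y a))\<^sup>2) \<partial>M)"
    by (subst nn_integral_distr) auto
  also have "\<dots> = ennreal (\<integral>a. (dist (X a) (Y a))\<^sup>2 \<partial>M)"
    by (rule nn_integral_eq_integral[OF int]) simp
  finally show ?thesis
    by (simp add: W2_def enn2real_leI)
qed

text \<open>The easy half of Kantorovich duality. The exceptional set constrains \<open>x\<close>
  alone, so it pulls back along \<open>snd\<close> to a null set of every coupling.\<close>

lemma W2_ge:
  fixes \<nu> \<sigma> :: "'a::euclidean_space measure"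
  assumes \<nu>: "\<nu> \<in> P2 UNIV" and \<sigma>: "\<sigma> \<in> P2 UNIV"
    and h: "integrable \<nu> h" and e: "integrable \<sigma> e"
    and le: "AE x in \<sigma>. \<forall>y. h y + e x \<le> (dist y x)\<^sup>2"
  shows "integral\<^sup>L \<nu> h + integral\<^sup>L \<sigma> e \<le> (W2 \<nu> \<sigma>)\<^sup>2"
proof -
  let ?I = "\<lambda>\<pi>. \<integral>\<^sup>+ z. ennreal ((dist (fst z) (snd z))\<^sup>2) \<partial>\<pi>"
  let ?r = "integral\<^sup>L \<nu> h + integral\<^sup>L \<sigma> e"
  interpret \<nu>: prob_space \<nu> using \<nu> by (simp add: P2_def)
  interpret \<sigma>: prob_space \<sigma> using \<sigma> by (simp add: P2_def)
  have sets[measurable_cong]: "sets \<nu> = sets borel" "sets \<sigma> = sets borel"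
    using \<nu> \<sigma> by (auto simp: P2_def)
  have bound: "integrable \<pi> (\<lambda>z. (dist (fst z) (snd z))\<^sup>2) \<and> ennreal ?r \<le> ?I \<pi>"
    if "\<pi> \<in> couplings \<nu> \<sigma>" for \<pi>
  proof -
    have s[measurable_cong]: "sets \<pi> = sets (borel \<Otimes>\<^sub>M borel)"
      and d: "distr \<pi> borel fst = \<nu>" "distr \<pi> borel snd = \<sigma>"
      using that by (auto simp: couplings_def)
    have [measurable]: "fst \<in> borel_measurable \<pi>" "snd \<in> borel_measurable \<pi>"
      by measurable
    have ih: "integrable \<pi> (\<lambda>z. h (fst z))" and ie: "integrable \<pi> (\<lambda>z. e (snd z))"
      using h e integrable_distr[of fst \<pi> borel h] integrable_distr[of snd \<pi> borel e] by (auto simp: d)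
    have i1: "integrable \<pi> (\<lambda>z. (norm (fst z))\<^sup>2)" "integrable \<pi> (\<lambda>z. (norm (snd z))\<^sup>2)"
      using \<nu> \<sigma> integrable_distr[of fst \<pi> borel "\<lambda>y. (norm y)\<^sup>2"]
        integrable_distr[of snd \<pi> borel "\<lambda>y. (norm y)\<^sup>2"] by (auto simp: d P2_def)
    have ic: "integrable \<pi> (\<lambda>z. (dist (fst z) (snd z))\<^sup>2)"
    proof (rule Bochner_Integration.integrable_bound)
      show "integrable \<pi> (\<lambda>z. 2 * (norm (fst z))\<^sup>2 + 2 * (norm (snd z))\<^sup>2)"
        using i1 by auto
    qed (auto intro!: AE_I2 dist_sq_le)
    have "AE x in distr \<pi> borel snd. \<forall>y. h y + e x \<le> (dist y x)\<^sup>2" using le unfolding d .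
    then have "AE z in \<pi>. h (fst z) + e (snd z) \<le> (dist (fst z) (snd z))\<^sup>2"
      by (drule_tac AE_distrD[rotated]) auto
    then have "(\<integral>z. h (fst z) + e (snd z) \<partial>\<pi>) \<le> (\<integral>z. (dist (fst z) (snd z))\<^sup>2 \<partial>\<pi>)"
      using ih ie ic by (intro integral_mono_AE) auto
    moreover have "(\<integral>z. h (fst z) + e (snd z) \<partial>\<pi>) = ?r"
      using ih ie h e integral_distr[of fst \<pi> borel h] integral_distr[of snd \<pi> borel e]
      by (simp add: d sets cong: measurable_cong_sets)
    moreover have "?I \<pi> = ennreal (\<integral>z. (dist (fst z) (snd z))\<^sup>2 \<partial>\<pi>)"
      by (rule nn_integral_eq_integral[OF ic]) simp
    ultimately show ?thesis using ic by (simp add: ennreal_leI)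
  qed
  \<comment> \<open>A coupling of finite cost keeps the infimum below \<open>top\<close>, which
    \<open>enn2real\<close> would send to 0.\<close>
  have prod: "\<nu> \<Otimes>\<^sub>M \<sigma> \<in> couplings \<nu> \<sigma>"
  proof -
    interpret pair_sigma_finite \<nu> \<sigma> ..
    have 1: "distr (\<nu> \<Otimes>\<^sub>M \<sigma>) borel fst = \<nu>"
      using \<sigma>.distr_pair_fst[of \<nu>] sets(1) by (simp cong: distr_cong)
    have "distr (\<nu> \<Otimes>\<^sub>M \<sigma>) borel snd = distr (distr (\<sigma> \<Otimes>\<^sub>M \<nu>) (\<nu> \<Otimes>\<^sub>M \<sigma>) (\<lambda>(x, y). (y, x))) borel snd"
      by (subst distr_pair_swap) simp
    also have "\<dots> = distr (\<sigma> \<Otimes>\<^sub>M \<nu>) borel fst"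
      by (subst distr_distr) (auto simp: comp_def case_prod_unfold)
    also have "\<dots> = \<sigma>"
      using \<nu>.distr_pair_fst[of \<sigma>] sets(2) by (simp cong: distr_cong)
    finally show ?thesis using 1 by (simp add: couplings_def sets cong: sets_pair_measure_cong)
  qed
  have "(INF \<pi>\<in>couplings \<nu> \<sigma>. ?I \<pi>) \<le> ?I (\<nu> \<Otimes>\<^sub>M \<sigma>)"
    by (rule INF_lower[OF prod])
  also have "\<dots> = ennreal (\<integral>z. (dist (fst z) (snd z))\<^sup>2 \<partial>(\<nu> \<Otimes>\<^sub>M \<sigma>))"
    using bound[OF prod] by (intro nn_integral_eq_integral) auto
  also have "\<dots> < top" by simp
  finally have fin: "(INF \<pi>\<in>couplings \<nu> \<sigma>. ?I \<pi>) < top" .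
  have "ennreal ?r \<le> (INF \<pi>\<in>couplings \<nu> \<sigma>. ?I \<pi>)"
    using bound by (intro INF_greatest) blast
  then have "enn2real (ennreal ?r) \<le> enn2real (INF \<pi>\<in>couplings \<nu> \<sigma>. ?I \<pi>)"
    using fin by (rule enn2real_mono)
  \<comment> \<open>A negative \<open>?r\<close> is truncated to 0 by \<open>ennreal\<close>, which
    only increases it.\<close>
  moreover have "?r \<le> enn2real (ennreal ?r)" by (cases "0 \<le> ?r") (auto simp: ennreal_neg)
  ultimately show ?thesis by (simp add: W2_def)
qed

section \<open>Dual certificates for barycenters\<close>

text \<open>The index set may be uncountable. Continuity in \<open>x\<close> makes the strict
  sublevel sets unions of open sets.\<close>

lemma inf_dist_sq_measurable:
  fixes f :: "'i \<Rightarrow> 'a::euclidean_space" and g :: "'i \<Rightarrow> real"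
  assumes "A \<noteq> {}" and bdd: "\<And>x. bdd_below ((\<lambda>a. (dist x (f a))\<^sup>2 - g a) ` A)"
  shows "(\<lambda>x. INF a\<in>A. (dist x (f a))\<^sup>2 - g a) \<in> borel_measurable borel"
proof (rule borel_measurableI_less)
  fix c
  have "{x. (INF a\<in>A. (dist x (f a))\<^sup>2 - g a) < c} = (\<Union>a\<in>A. {x. (dist x (f a))\<^sup>2 - g a < c})"
    using assms by (auto simp: cINF_less_iff)
  moreover have "open (\<Union>a\<in>A. {x. (dist x (f a))\<^sup>2 - g a < c})"
    by (intro open_UN ballI open_Collect_less continuous_intros)
  ultimately show "{x \<in> space borel. (INF a\<in>A. (dist x (f a))\<^sup>2 - g a) < c} \<in> sets borel" by simp
qed

lemma INF_ereal_dist_sq_measurable: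
  fixes f :: "'i \<Rightarrow> 'a::euclidean_space" and g :: "'i \<Rightarrow> real"
  shows "(\<lambda>x. INF a\<in>A. ereal ((dist x (f a))\<^sup>2 - g a)) \<in> borel_measurable borel"
proof (rule borel_measurableI_less)
  fix c
  have "{x. (INF a\<in>A. ereal ((dist x (f a))\<^sup>2 - g a)) < c} =
      (\<Union>a\<in>A. {x. ereal ((dist x (f a))\<^sup>2 - g a) < c})"
    by (auto simp: INF_less_iff)
  moreover have "open (\<Union>a\<in>A. {x. ereal ((dist x (f a))\<^sup>2 - g a) < c})"
    by (intro open_UN ballI open_Collect_less continuous_intros)
  ultimately show "{x \<in> space borel. (INF a\<in>A. ereal ((dist x (f a))\<^sup>2 - g a)) < c} \<in> sets borel"
    by simp
qed

lemma sum_fun_upd_other: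
  fixes F :: "nat \<Rightarrow> 'b \<Rightarrow> real"
  assumes "finite A" "j \<in> A"
  shows "(\<Sum>i\<in>A. F i ((f(j := x)) i)) = F j x + (\<Sum>i\<in>A - {j}. F i (f i))"
proof -
  have "(\<Sum>i\<in>A. F i ((f(j := x)) i)) = F j x + (\<Sum>i\<in>A - {j}. F i ((f(j := x)) i))"
    using sum.remove[OF assms, of "\<lambda>i. F i ((f(j := x)) i)"] by simp
  also have "(\<Sum>i\<in>A - {j}. F i ((f(j := x)) i)) = (\<Sum>i\<in>A - {j}. F i (f i))"
    by (rule sum.cong) auto
  finally show ?thesis .
qed

lemma integrable_norm_sq_sum:
  fixes X :: "'i \<Rightarrow> 'a \<Rightarrow> 'b::euclidean_space"
  assumes "finite A" "\<And>j. j \<in> A \<Longrightarrow> X j \<in> borel_measurable M"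
    and "\<And>j. j \<in> A \<Longrightarrow> integrable M (\<lambda>a. (norm (X j a))\<^sup>2)"
  shows "integrable M (\<lambda>a. (norm (\<Sum>j\<in>A. c j *\<^sub>R X j a))\<^sup>2)"
  using assms
proof (induction A rule: finite_induct)
  case (insert j A)
  let ?s = "\<lambda>a. \<Sum>j\<in>A. c j *\<^sub>R X j a"
  have s: "integrable M (\<lambda>a. (norm (?s a))\<^sup>2)" using insert by auto
  have 1: "integrable M (\<lambda>a. 2 * ((c j)\<^sup>2 * (norm (X j a))\<^sup>2) + 2 * (norm (?s a))\<^sup>2)"
    using s insert.prems(2) by (intro Bochner_Integration.integrable_add integrable_mult_right) auto
  have "integrable M (\<lambda>a. (norm (c j *\<^sub>R X j a + ?s a))\<^sup>2)"
  proof (rule Bochner_Integration.integrable_bound[OF 1])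
    show "(\<lambda>a. (norm (c j *\<^sub>R X j a + ?s a))\<^sup>2) \<in> borel_measurable M"
      using insert.prems(1) by measurable
    have "(norm (c j *\<^sub>R X j a + ?s a))\<^sup>2 \<le> 2 * ((c j)\<^sup>2 * (norm (X j a))\<^sup>2) + 2 * (norm (?s a))\<^sup>2" for a
      using dist_sq_le[of "c j *\<^sub>R X j a" "- ?s a"] by (simp add: dist_norm power_mult_distrib)
    then show "AE a in M. norm ((norm (c j *\<^sub>R X j a + ?s a))\<^sup>2) \<le>
        norm (2 * ((c j)\<^sup>2 * (norm (X j a))\<^sup>2) + 2 * (norm (?s a))\<^sup>2)"
      by (auto intro!: AE_I2 order.trans[OF _ abs_ge_self])
  qed
  then show ?case using insert.hyps by simp
qed simp

text \<open>The functions \<open>G j\<close> play the role of the multi-marginal dual potentials for the cost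
  \<open>min\<^sub>y \<Sum>\<^sub>j w\<^sub>j |y - x\<^sub>j|\<^sup>2\<close>, pulled back to \<open>space M\<close>. Working on \<open>space M\<close> rather than on
  the supports avoids inverting the maps \<open>X j\<close>.\<close>

locale barycenter_dual = prob_space M for M :: "'a measure" +
  fixes n :: nat and w :: "nat \<Rightarrow> real" and X :: "nat \<Rightarrow> 'a \<Rightarrow> 'b::euclidean_space"
    and G :: "nat \<Rightarrow> 'a \<Rightarrow> real"
  assumes n: "n \<ge> 1"
    and w_pos: "\<And>j. j \<in> {1..n} \<Longrightarrow> 0 < w j"
    and w_sum: "(\<Sum>j=1..n. w j) = 1"
    and X_meas: "\<And>j. j \<in> {1..n} \<Longrightarrow> X j \<in> borel_measurable M"
    and X_sq: "\<And>j. j \<in> {1..n} \<Longrightarrow> integrable M (\<lambda>a. (norm (X j a))\<^sup>2)"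
    and dual_le: "\<And>y a. (\<And>j. j \<in> {1..n} \<Longrightarrow> a j \<in> space M) \<Longrightarrow>
      (\<Sum>j=1..n. w j * G j (a j)) \<le> (\<Sum>j=1..n. w j * (dist y (X j (a j)))\<^sup>2)"
    and dual_ge: "\<And>b. b \<in> space M \<Longrightarrow>
      (\<Sum>j=1..n. w j * (dist (\<Sum>i=1..n. w i *\<^sub>R X i b) (X j b))\<^sup>2) \<le> (\<Sum>j=1..n. w j * G j b)"
begin

section \<open>The transformed potentials and complementary slackness\<close>

definition S :: "'a \<Rightarrow> 'b" where "S b = (\<Sum>i=1..n. w i *\<^sub>R X i b)"

text \<open>The c-transform of \<open>G j\<close> for the squared distance, with the infimum taken
  over parameters \<open>a\<close> instead of points \<open>X j a\<close>.\<close>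

definition h :: "nat \<Rightarrow> 'b \<Rightarrow> real" where
  "h j y = (INF a\<in>space M. (dist y (X j a))\<^sup>2 - G j a)"

text \<open>Freezing all arguments of \<open>dual_le\<close> except the \<open>j\<close>-th gives a
  lower bound that is uniform in that argument.\<close>

lemma h_bdd:
  assumes j: "j \<in> {1..n}"
  shows "bdd_below ((\<lambda>a. (dist y (X j a))\<^sup>2 - G j a) ` space M)"
proof -
  obtain b where b: "b \<in> space M" using not_empty by blast
  define C where "C = (\<Sum>i\<in>{1..n} - {j}. w i * G i b) - (\<Sum>i\<in>{1..n} - {j}. w i * (dist y (X i b))\<^sup>2)"
  have "C / w j \<le> (dist y (X j a))\<^sup>2 - G j a" if a: "a \<in> space M" for a
  proof -
    have "(\<Sum>i=1..n. w i * G i (((\<lambda>_. b)(j := a)) i)) \<le>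
        (\<Sum>i=1..n. w i * (dist y (X i (((\<lambda>_. b)(j := a)) i)))\<^sup>2)"
      using a b by (intro dual_le) auto
    then have "w j * G j a + C \<le> w j * (dist y (X j a))\<^sup>2"
      using sum_fun_upd_other[of "{1..n}" j "\<lambda>i x. w i * G i x" "\<lambda>_. b" a]
        sum_fun_upd_other[of "{1..n}" j "\<lambda>i x. w i * (dist y (X i x))\<^sup>2" "\<lambda>_. b" a] j
      by (simp add: C_def)
    then show ?thesis using w_pos[OF j] by (simp add: field_simps)
  qed
  then show ?thesis by (auto intro!: bdd_belowI)
qed

lemma h_le: "j \<in> {1..n} \<Longrightarrow> a \<in> space M \<Longrightarrow> h j y + G j a \<le> (dist y (X j a))\<^sup>2"
  unfolding h_def using cINF_lower[OF h_bdd, of j a y] by simp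

lemma h_measurable [measurable]: "j \<in> {1..n} \<Longrightarrow> h j \<in> borel_measurable borel"
  using inf_dist_sq_measurable[OF not_empty h_bdd, of j] by (simp add: h_def[abs_def])

text \<open>The arguments in \<open>dual_le\<close> are independent of each other, so each can be
  chosen nearly optimal for its own infimum.\<close>

lemma sum_h_nonneg: "0 \<le> (\<Sum>j=1..n. w j * h j y)"
proof (rule field_le_epsilon)
  fix \<epsilon> :: real assume "0 < \<epsilon>"
  have "\<exists>a\<in>space M. (dist y (X j a))\<^sup>2 - G j a < h j y + \<epsilon>" if "j \<in> {1..n}" for j
    using cINF_less_iff[OF not_empty h_bdd[OF that, of y], of "h j y + \<epsilon>"] \<open>0 < \<epsilon>\<close>
    by (simp add: h_def)
  then obtain a where a: "\<And>j. j \<in> {1..n} \<Longrightarrow> a j \<in> space M"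
    "\<And>j. j \<in> {1..n} \<Longrightarrow> (dist y (X j (a j)))\<^sup>2 - G j (a j) < h j y + \<epsilon>" by metis
  have "0 \<le> (\<Sum>j=1..n. w j * ((dist y (X j (a j)))\<^sup>2 - G j (a j)))"
    using dual_le[of a y] a(1) by (simp add: right_diff_distrib sum_subtractf)
  also have "\<dots> \<le> (\<Sum>j=1..n. w j * (h j y + \<epsilon>))"
    using a(2) w_pos by (intro sum_mono mult_left_mono) (auto simp: less_imp_le)
  also have "\<dots> = (\<Sum>j=1..n. w j * h j y) + \<epsilon>"
    by (simp add: distrib_left sum.distrib sum_distrib_right[symmetric] w_sum[simplified])
  finally show "0 \<le> (\<Sum>j=1..n. w j * h j y) + \<epsilon>" .
qed

text \<open>A fixed competitor \<open>b\<close> bounds every \<open>h i\<close> from above;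
  \<open>sum_h_nonneg\<close> turns the upper bounds for the other indices into a lower bound for
  \<open>h j\<close>.\<close>

lemma h_quadratic:
  assumes j: "j \<in> {1..n}"
  shows "\<exists>A B. \<forall>y. \<bar>h j y\<bar> \<le> A + B * (norm y)\<^sup>2"
proof -
  obtain b where b: "b \<in> space M" using not_empty by blast
  define A0 where "A0 = (\<Sum>i=1..n. 2 * (norm (X i b))\<^sup>2 + \<bar>G i b\<bar>)"
  have A0: "0 \<le> A0" unfolding A0_def by (intro sum_nonneg) auto
  have up: "h i y \<le> A0 + 2 * (norm y)\<^sup>2" if i: "i \<in> {1..n}" for i y
  proof -
    have "h i y \<le> (dist y (X i b))\<^sup>2 - G i b" using h_le[OF i b, of y] by simp
    also have "\<dots> \<le> 2 * (norm y)\<^sup>2 + (2 * (norm (X i b))\<^sup>2 + \<bar>G i b\<bar>)"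
      using dist_sq_le[of y "X i b"] by linarith
    also have "2 * (norm (X i b))\<^sup>2 + \<bar>G i b\<bar> \<le> A0"
      unfolding A0_def using i by (intro member_le_sum) auto
    finally show ?thesis by simp
  qed
  have lo: "- (A0 + 2 * (norm y)\<^sup>2) \<le> w j * h j y" for y
  proof -
    have "(\<Sum>i\<in>{1..n} - {j}. w i * h i y) \<le> (\<Sum>i\<in>{1..n} - {j}. w i * (A0 + 2 * (norm y)\<^sup>2))"
      using up w_pos by (intro sum_mono mult_left_mono) (auto simp: less_imp_le)
    also have "\<dots> \<le> (\<Sum>i\<in>{1..n}. w i * (A0 + 2 * (norm y)\<^sup>2))"
      using w_pos A0 by (intro sum_mono2) (auto simp: less_imp_le)
    also have "\<dots> = A0 + 2 * (norm y)\<^sup>2" by (simp add: sum_distrib_right[symmetric] w_sum[simplified])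
    finally show ?thesis
      using sum_h_nonneg[of y] sum.remove[of "{1..n}" j "\<lambda>i. w i * h i y"] j by simp
  qed
  have "\<bar>h j y\<bar> \<le> (A0 + A0 / w j) + (2 + 2 / w j) * (norm y)\<^sup>2" for y
  proof -
    have 1: "- ((A0 + 2 * (norm y)\<^sup>2) / w j) \<le> h j y"
      using lo[of y] w_pos[OF j] by (simp add: field_simps)
    have 2: "0 \<le> (A0 + 2 * (norm y)\<^sup>2) / w j" using A0 w_pos[OF j] by simp
    have "\<bar>h j y\<bar> \<le> (A0 + 2 * (norm y)\<^sup>2) + (A0 + 2 * (norm y)\<^sup>2) / w j"
      using 1 2 up[OF j, of y] A0 zero_le_power2[of "norm y"] by (simp only: abs_le_iff) linarith
    then show ?thesis by (simp add: field_simps add_divide_distrib)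
  qed
  then show ?thesis by blast
qed

lemma h_integrable: "j \<in> {1..n} \<Longrightarrow> \<nu> \<in> P2 UNIV \<Longrightarrow> integrable \<nu> (h j)"
  using h_quadratic[of j] integrable_quadratic_bound[OF _ h_measurable] by blast

text \<open>Complementary slackness: the weighted gaps are nonnegative by \<open>h_le\<close>, and
  by \<open>dual_ge\<close> and \<open>sum_h_nonneg\<close> their sum is at most 0, so each
  vanishes.\<close>

lemma h_S:
  assumes j: "j \<in> {1..n}" and b: "b \<in> space M"
  shows "h j (S b) + G j b = (dist (S b) (X j b))\<^sup>2"
proof -
  have nn: "0 \<le> w i * ((dist (S b) (X i b))\<^sup>2 - G i b - h i (S b))" if "i \<in> {1..n}" for i
    using h_le[OF that b, of "S b"] w_pos[OF that] by simp
  have "(\<Sum>i=1..n. w i * ((dist (S b) (X i b))\<^sup>2 - G i b - h i (S b))) \<le> 0"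
    using dual_ge[OF b] sum_h_nonneg[of "S b"]
    by (simp add: right_diff_distrib sum_subtractf S_def)
  then have "(\<Sum>i=1..n. w i * ((dist (S b) (X i b))\<^sup>2 - G i b - h i (S b))) = 0"
    using sum_nonneg[of "{1..n}" "\<lambda>i. w i * ((dist (S b) (X i b))\<^sup>2 - G i b - h i (S b))"] nn by fastforce
  then have "w j * ((dist (S b) (X j b))\<^sup>2 - G j b - h j (S b)) = 0"
    using sum_nonneg_eq_0_iff[of "{1..n}" "\<lambda>i. w i * ((dist (S b) (X i b))\<^sup>2 - G i b - h i (S b))"]
      nn j by auto
  then show ?thesis using w_pos[OF j] by simp
qed

section \<open>Integrability and perturbed dual pairs\<close>

lemma S_measurable [measurable]: "S \<in> borel_measurable M"
  unfolding S_def[abs_def] using X_meas by auto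

lemma S_sq: "integrable M (\<lambda>a. (norm (S a))\<^sup>2)"
  unfolding S_def using X_meas X_sq by (intro integrable_norm_sq_sum) auto

lemma dist_sq_integrable:
  assumes j: "j \<in> {1..n}"
  shows "integrable M (\<lambda>a. (dist (S a) (X j a))\<^sup>2)"
proof (rule Bochner_Integration.integrable_bound)
  show "integrable M (\<lambda>a. 2 * (norm (S a))\<^sup>2 + 2 * (norm (X j a))\<^sup>2)"
    using S_sq X_sq[OF j] by auto
  show "(\<lambda>a. (dist (S a) (X j a))\<^sup>2) \<in> borel_measurable M"
    using X_meas[OF j] by measurable
qed (auto intro!: AE_I2 dist_sq_le)

text \<open>The partner of the potential \<open>h j + f\<close>. The detour through \<^typ>\<open>ereal\<close> keeps the infimum
  meaningful, hence measurable, off the image of \<open>X j\<close>, where it can be \<open>-\<infinity>\<close>.\<close>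

definition E :: "nat \<Rightarrow> ('b \<Rightarrow> real) \<Rightarrow> 'b \<Rightarrow> ereal" where
  "E j f x = (INF y. ereal ((dist x y)\<^sup>2 - (h j y + f y)))"

lemma E_measurable [measurable]: "E j f \<in> borel_measurable borel"
  using INF_ereal_dist_sq_measurable[where A=UNIV and f="\<lambda>y. y" and g="\<lambda>y. h j y + f y"] by (simp add: E_def[abs_def])

text \<open>The lower bound is \<open>h_le\<close> for every \<open>y\<close>; the upper bound takes
  \<open>y = S b\<close>, where \<open>h_S\<close> gives equality. For \<open>f = 0\<close> and
  \<open>t = 0\<close> the two bounds coincide.\<close>

lemma E_bounds:
  assumes j: "j \<in> {1..n}" and b: "b \<in> space M" and f: "\<And>y. f y \<le> t"
  shows "ereal (G j b - t) \<le> E j f (X j b)" and "E j f (X j b) \<le> ereal (G j b - f (S b))"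
proof -
  have "G j b - t \<le> (dist (X j b) y)\<^sup>2 - (h j y + f y)" for y
    using h_le[OF j b, of y] f[of y] by (simp add: dist_commute)
  then show "ereal (G j b - t) \<le> E j f (X j b)"
    unfolding E_def by (intro INF_greatest) simp
  have "E j f (X j b) \<le> ereal ((dist (X j b) (S b))\<^sup>2 - (h j (S b) + f (S b)))"
    unfolding E_def by (intro INF_lower) simp
  also have "\<dots> = ereal (G j b - f (S b))"
    using h_S[OF j b] by (simp add: dist_commute)
  finally show "E j f (X j b) \<le> ereal (G j b - f (S b))" .
qed

lemma G_integrable:
  assumes j: "j \<in> {1..n}"
  shows "integrable M (G j)"
proof (rule Bochner_Integration.integrable_bound)
  let ?B = "\<lambda>b. \<Sum>i=1..n. (norm (X i b))\<^sup>2 + \<bar>h i 0\<bar>"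
  show "integrable M (\<lambda>b. ?B b + ?B b / w j)"
    using X_sq by (intro Bochner_Integration.integrable_add Bochner_Integration.integrable_divide
        Bochner_Integration.integrable_sum) auto
  \<comment> \<open>The locale does not assume \<open>G j\<close> measurable; this identity supplies
    measurability.\<close>
  have "real_of_ereal (E j (\<lambda>_. 0) (X j b)) = G j b" if "b \<in> space M" for b
  proof -
    have "E j (\<lambda>_. 0) (X j b) = ereal (G j b)"
      using E_bounds[OF j that, of "\<lambda>_. 0" 0] by (intro antisym) auto
    then show ?thesis by simp
  qed
  moreover have "(\<lambda>b. real_of_ereal (E j (\<lambda>_. 0) (X j b))) \<in> borel_measurable M"
    using X_meas[OF j] by measurable
  ultimately show "G j \<in> borel_measurable M"
    by (simp cong: measurable_cong)
  show "AE b in M. norm (G j b) \<le> norm (?B b + ?B b / w j)"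
  proof (rule AE_I2)
    fix b assume b: "b \<in> space M"
    have B: "0 \<le> ?B b" by (intro sum_nonneg) auto
    \<comment> \<open>Upper bounds come from \<open>h_le\<close> at the origin. The lower bound for
      \<open>G j\<close> follows from these, since \<open>dual_ge\<close> makes the weighted sum of
      the \<open>G i b\<close> nonnegative.\<close>
    have up: "G i b \<le> ?B b" if i: "i \<in> {1..n}" for i
    proof -
      have "G i b \<le> (norm (X i b))\<^sup>2 + \<bar>h i 0\<bar>" using h_le[OF i b, of 0] by simp
      also have "\<dots> \<le> ?B b" using i by (intro member_le_sum) auto
      finally show ?thesis .
    qed
    have "(\<Sum>i\<in>{1..n} - {j}. w i * G i b) \<le> (\<Sum>i\<in>{1..n} - {j}. w i * ?B b)"
      using up w_pos by (intro sum_mono mult_left_mono) (auto simp: less_imp_le)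
    also have "\<dots> \<le> (\<Sum>i\<in>{1..n}. w i * ?B b)"
      using w_pos B by (intro sum_mono2) (auto simp: less_imp_le)
    also have "\<dots> = ?B b" by (subst sum_distrib_right[symmetric]) (simp add: w_sum[simplified])
    finally have "(\<Sum>i\<in>{1..n} - {j}. w i * G i b) \<le> ?B b" .
    moreover have "0 \<le> (\<Sum>i=1..n. w i * G i b)"
      using w_pos by (intro order.trans[OF _ dual_ge[OF b]] sum_nonneg) (auto simp: less_imp_le)
    ultimately have "- ?B b \<le> w j * G j b"
      using sum.remove[of "{1..n}" j "\<lambda>i. w i * G i b"] j by simp
    then have "- ?B b / w j \<le> G j b"
      using w_pos[OF j] by (simp only: pos_divide_le_eq mult.commute)
    moreover have "0 \<le> ?B b / w j" using B w_pos[OF j] by (simp only: divide_nonneg_pos)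
    moreover have "\<bar>g\<bar> \<le> \<bar>x + z\<bar>" if "- z \<le> g" "g \<le> x" "0 \<le> x" "0 \<le> z" for g x z :: real
      using that by linarith
    ultimately show "norm (G j b) \<le> norm (?B b + ?B b / w j)"
      using up[OF j] B by (simp only: real_norm_def minus_divide_left)
  qed
qed

text \<open>For \<open>f\<close> bounded above, \<open>E j f\<close> is finite on the image of
  \<open>X j\<close> (see \<open>e_bounds\<close>), so the conversion to reals loses nothing
  there.\<close>

abbreviation e :: "nat \<Rightarrow> ('b \<Rightarrow> real) \<Rightarrow> 'a \<Rightarrow> real" where
  "e j f b \<equiv> real_of_ereal (E j f (X j b))"

lemma e_bounds:
  assumes j: "j \<in> {1..n}" and b: "b \<in> space M" and f: "\<And>y. f y \<le> t"
  shows "\<bar>E j f (X j b)\<bar> \<noteq> \<infinity>" "G j b - t \<le> e j f b" "e j f b \<le> G j b - f (S b)"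
proof -
  have 1: "ereal (G j b - t) \<le> E j f (X j b)" and 2: "E j f (X j b) \<le> ereal (G j b - f (S b))"
    using E_bounds[of j b f t, OF assms] by blast+
  then obtain r where r: "E j f (X j b) = ereal r"
    by (cases "E j f (X j b)") auto
  show "\<bar>E j f (X j b)\<bar> \<noteq> \<infinity>" "G j b - t \<le> e j f b" "e j f b \<le> G j b - f (S b)"
    using 1 2 unfolding r by simp_all
qed

lemma X_moment: "j \<in> {1..n} \<Longrightarrow> distr M borel (X j) \<in> P2 UNIV"
  using P2_UNIV_distrI[OF prob_space_axioms X_meas X_sq] .

lemma e_integrable:
  assumes j: "j \<in> {1..n}" and f: "\<And>y. 0 \<le> f y" "\<And>y. f y \<le> t"
  shows "integrable M (e j f)"
proof (rule Bochner_Integration.integrable_bound)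
  show "integrable M (\<lambda>b. \<bar>G j b\<bar> + \<bar>t\<bar>)" using G_integrable[OF j] by auto
  show "e j f \<in> borel_measurable M" using X_meas[OF j] by measurable
  show "AE b in M. norm (e j f b) \<le> norm (\<bar>G j b\<bar> + \<bar>t\<bar>)"
  proof (rule AE_I2)
    fix b assume "b \<in> space M"
    then have "G j b - t \<le> e j f b" "e j f b \<le> G j b"
      using e_bounds(2,3)[of j b f, OF j _ f(2)] f(1)[of "S b"] by auto
    then show "norm (e j f b) \<le> norm (\<bar>G j b\<bar> + \<bar>t\<bar>)"
      by (simp only: real_norm_def abs_le_iff) linarith
  qed
qed

text \<open>By construction of \<open>E\<close>, the functions \<open>h j + f\<close> and
  \<open>E j f\<close> form an admissible dual pair for \<open>W2_ge\<close>.\<close>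

lemma W2_ge_dual:
  assumes j: "j \<in> {1..n}" and \<nu>: "\<nu> \<in> P2 UNIV"
    and f: "f \<in> borel_measurable borel" "\<And>y. 0 \<le> f y" "\<And>y. f y \<le> t"
  shows "integral\<^sup>L \<nu> (h j) + integral\<^sup>L \<nu> f + integral\<^sup>L M (e j f) \<le> (W2 \<nu> (distr M borel (X j)))\<^sup>2"
proof -
  have f_int: "integrable \<nu> f"
    by (rule integrable_quadratic_bound[where A=t and B=0, OF \<nu> f(1)]) (use f in auto)
  have "integral\<^sup>L \<nu> (\<lambda>y. h j y + f y) + integral\<^sup>L (distr M borel (X j)) (\<lambda>x. real_of_ereal (E j f x))
      \<le> (W2 \<nu> (distr M borel (X j)))\<^sup>2"
  proof (rule W2_ge[OF \<nu> X_moment[OF j]])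
    show "integrable \<nu> (\<lambda>y. h j y + f y)" using h_integrable[OF j \<nu>] f_int by auto
    show "integrable (distr M borel (X j)) (\<lambda>x. real_of_ereal (E j f x))"
      using X_meas[OF j] e_integrable[OF j f(2,3)] by (subst integrable_distr_eq) auto
    have "AE x in distr M borel (X j). \<bar>E j f x\<bar> \<noteq> \<infinity>"
      using X_meas[OF j] e_bounds(1)[OF j _ f(3)] by (subst AE_distr_iff) (auto intro!: AE_I2)
    then show "AE x in distr M borel (X j). \<forall>y. h j y + f y + real_of_ereal (E j f x) \<le> (dist y x)\<^sup>2"
    proof (eventually_elim, intro allI)
      fix x y assume "\<bar>E j f x\<bar> \<noteq> \<infinity>"
      moreover have "E j f x \<le> ereal ((dist x y)\<^sup>2 - (h j y + f y))"
        unfolding E_def by (rule INF_lower) simp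
      ultimately show "h j y + f y + real_of_ereal (E j f x) \<le> (dist y x)\<^sup>2"
        by (cases "E j f x") (auto simp: dist_commute)
    qed
  qed
  moreover have "integral\<^sup>L \<nu> (\<lambda>y. h j y + f y) = integral\<^sup>L \<nu> (h j) + integral\<^sup>L \<nu> f"
    using h_integrable[OF j \<nu>] f_int by simp
  moreover have "integral\<^sup>L (distr M borel (X j)) (\<lambda>x. real_of_ereal (E j f x)) = integral\<^sup>L M (e j f)"
    using X_meas[OF j] by (subst integral_distr) auto
  ultimately show ?thesis by simp
qed

section \<open>Minimal cost and uniqueness of the minimizer\<close>

definition cost :: "'b measure \<Rightarrow> real" where
  "cost \<nu> = (\<Sum>j=1..n. w j * (W2 \<nu> (distr M borel (X j)))\<^sup>2)"

text \<open>The dual value; \<open>cost_ge\<close> and \<open>cost_S\<close> show that it is the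
  minimum of \<open>cost\<close> over \<open>P2 UNIV\<close>.\<close>

definition val :: real where "val = (\<Sum>j=1..n. w j * integral\<^sup>L M (G j))"

lemma S_moment: "distr M borel S \<in> P2 UNIV"
  using P2_UNIV_distrI[OF prob_space_axioms S_measurable S_sq] .

lemma W2_ge_G:
  assumes j: "j \<in> {1..n}" and \<nu>: "\<nu> \<in> P2 UNIV"
  shows "integral\<^sup>L \<nu> (h j) + integral\<^sup>L M (G j) \<le> (W2 \<nu> (distr M borel (X j)))\<^sup>2"
proof -
  have "e j (\<lambda>_. 0) b = G j b" if "b \<in> space M" for b
    using e_bounds(2,3)[OF j that, of "\<lambda>_. 0" 0] by simp
  then have "integral\<^sup>L M (e j (\<lambda>_. 0)) = integral\<^sup>L M (G j)"
    by (intro Bochner_Integration.integral_cong) auto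
  then show ?thesis using W2_ge_dual[OF j \<nu>, of "\<lambda>_. 0" 0] by simp
qed

lemma sum_int_h_nonneg:
  assumes "\<nu> \<in> P2 UNIV"
  shows "0 \<le> (\<Sum>j=1..n. w j * integral\<^sup>L \<nu> (h j))"
proof -
  have "0 \<le> (\<integral>y. (\<Sum>j=1..n. w j * h j y) \<partial>\<nu>)"
    using sum_h_nonneg by (intro Bochner_Integration.integral_nonneg)
  also have "\<dots> = (\<Sum>j=1..n. w j * integral\<^sup>L \<nu> (h j))"
    using h_integrable[OF _ assms] by (subst Bochner_Integration.integral_sum) auto
  finally show ?thesis .
qed

lemma cost_ge:
  assumes \<nu>: "\<nu> \<in> P2 UNIV"
  shows "val \<le> cost \<nu>"
proof -
  have "(\<Sum>j=1..n. w j * (integral\<^sup>L \<nu> (h j) + integral\<^sup>L M (G j))) \<le> cost \<nu>"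
    unfolding cost_def using W2_ge_G[OF _ \<nu>] w_pos
    by (intro sum_mono mult_left_mono) (auto simp: less_imp_le)
  then show ?thesis
    using sum_int_h_nonneg[OF \<nu>] by (simp add: val_def distrib_left sum.distrib)
qed

text \<open>Transporting each \<open>S a\<close> to \<open>X j a\<close> gives couplings whose total
  cost is controlled by \<open>dual_ge\<close>.\<close>

lemma cost_S: "cost (distr M borel S) \<le> val"
proof -
  have "cost (distr M borel S) \<le> (\<Sum>j=1..n. w j * (\<integral>a. (dist (S a) (X j a))\<^sup>2 \<partial>M))"
    unfolding cost_def using w_pos
    by (intro sum_mono mult_left_mono W2_le[OF prob_space_axioms S_measurable X_meas dist_sq_integrable])
      (auto simp: less_imp_le)
  also have "\<dots> = (\<integral>a. (\<Sum>j=1..n. w j * (dist (S a) (X j a))\<^sup>2) \<partial>M)"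
    using dist_sq_integrable by (subst Bochner_Integration.integral_sum) auto
  also have "\<dots> \<le> (\<integral>a. (\<Sum>j=1..n. w j * G j a) \<partial>M)"
    using dist_sq_integrable G_integrable dual_ge
    by (intro integral_mono) (auto simp: S_def)
  also have "\<dots> = val"
    unfolding val_def using G_integrable by (subst Bochner_Integration.integral_sum) auto
  finally show ?thesis .
qed

text \<open>Perturbing one potential \<open>h n\<close> by a small multiple of a test function \<open>f\<close> and letting the
  multiple tend to \<open>0\<close> identifies \<open>\<nu>\<close>: to first order, the change of \<open>e n\<close> at \<open>X n b\<close> is \<open>f\<close>
  evaluated at the contact points of \<open>b\<close>, and the gap hypothesis forces these to be
  \<open>S b\<close>. No optimal coupling has to exist for this.\<close>

lemma minimizer_unique:
  assumes \<nu>: "\<nu> \<in> P2 UNIV" and min: "cost \<nu> \<le> val"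
    and gap: "\<And>b \<delta>. b \<in> space M \<Longrightarrow> 0 < \<delta> \<Longrightarrow>
      \<exists>\<eta>>0. \<forall>y. \<delta> \<le> dist y (S b) \<longrightarrow> h n y + G n b + \<eta> \<le> (dist y (X n b))\<^sup>2"
  shows "\<nu> = distr M borel S"
proof (rule borel_measure_eqI_continuous)
  have nn: "n \<in> {1..n}" using n by simp
  fix f :: "'b \<Rightarrow> real"
  assume f: "continuous_on UNIV f" "\<And>x. 0 \<le> f x" "\<And>x. f x \<le> 1"
  have f_meas [measurable]: "f \<in> borel_measurable borel"
    using f(1) by (rule borel_measurable_continuous_onI)
  define t where "t k = 1 / real (Suc k)" for k
  have t: "0 < t k" for k by (simp add: t_def)
  have t_lim: "t \<longlonglongrightarrow> 0" unfolding t_def by (rule LIMSEQ_Suc[OF lim_1_over_n])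
  \<comment> \<open>The decrease of the \<open>n\<close>-th partner potential per unit of
    perturbation \<open>t k * f\<close>.\<close>
  define d where "d k b = (G n b - e n (\<lambda>y. t k * f y) b) / t k" for k b
  have tf: "0 \<le> t k * f y" "t k * f y \<le> t k" for k y
    using t[of k] f(2,3)[of y] by (auto simp: mult_left_le less_imp_le)
  have int_e: "integrable M (e n (\<lambda>y. t k * f y))" for k
    by (rule e_integrable[OF nn tf])
  have split: "(\<Sum>j=1..n. F j) = (\<Sum>j\<in>{1..n}-{n}. F j) + F n" for F :: "nat \<Rightarrow> real"
    using sum.remove[OF _ nn, of F] by simp
  \<comment> \<open>Only the \<open>n\<close>-th dual pair is perturbed. Since
    \<open>cost \<nu>\<close> is at most \<open>val\<close> and the weighted integrals of the
    \<open>h j\<close> are nonnegative, the gain from \<open>f\<close> cannot exceed the loss in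
    \<open>e n\<close>.\<close>
  have le: "integral\<^sup>L \<nu> f \<le> integral\<^sup>L M (d k)" for k
  proof -
    have "(\<Sum>j\<in>{1..n}-{n}. w j * (integral\<^sup>L \<nu> (h j) + integral\<^sup>L M (G j))) +
        w n * (integral\<^sup>L \<nu> (h n) + t k * integral\<^sup>L \<nu> f + integral\<^sup>L M (e n (\<lambda>y. t k * f y)))
      \<le> (\<Sum>j\<in>{1..n}-{n}. w j * (W2 \<nu> (distr M borel (X j)))\<^sup>2) +
        w n * (W2 \<nu> (distr M borel (X n)))\<^sup>2"
    proof (rule add_mono)
      show "w n * (integral\<^sup>L \<nu> (h n) + t k * integral\<^sup>L \<nu> f + integral\<^sup>L M (e n (\<lambda>y. t k * f y)))
          \<le> w n * (W2 \<nu> (distr M borel (X n)))\<^sup>2"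
        using W2_ge_dual[of n \<nu> "\<lambda>y. t k * f y", OF nn \<nu> _ tf] w_pos[OF nn]
        by (simp add: less_imp_le)
    qed (use W2_ge_G[OF _ \<nu>] w_pos in \<open>auto intro!: sum_mono mult_left_mono simp: less_imp_le\<close>)
    also have "\<dots> = cost \<nu>"
      unfolding cost_def split ..
    also have "\<dots> \<le> val" by fact
    also have "\<dots> = (\<Sum>j\<in>{1..n}-{n}. w j * integral\<^sup>L M (G j)) + w n * integral\<^sup>L M (G n)"
      unfolding val_def split ..
    finally have "w n * (t k * integral\<^sup>L \<nu> f + integral\<^sup>L M (e n (\<lambda>y. t k * f y)) - integral\<^sup>L M (G n)) \<le> 0"
      using sum_int_h_nonneg[OF \<nu>] unfolding split
      by (simp add: distrib_left sum.distrib right_diff_distrib)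
    then have "t k * integral\<^sup>L \<nu> f + integral\<^sup>L M (e n (\<lambda>y. t k * f y)) - integral\<^sup>L M (G n) \<le> 0"
      using w_pos[OF nn] by (simp add: mult_le_0_iff)
    then have "integral\<^sup>L \<nu> f \<le> (integral\<^sup>L M (G n) - integral\<^sup>L M (e n (\<lambda>y. t k * f y))) / t k"
      using t[of k] by (simp add: field_simps)
    also have "\<dots> = integral\<^sup>L M (d k)"
      unfolding d_def using int_e[of k] G_integrable[OF nn] by simp
    finally show ?thesis .
  qed
  have d_lower: "f (S b) \<le> d k b" and d_upper: "d k b \<le> 1" if b: "b \<in> space M" for b k
    using e_bounds(2,3)[of n b "\<lambda>y. t k * f y", OF nn b tf(2)] t[of k]
    by (simp_all add: d_def divide_le_eq le_divide_eq mult.commute[of _ "t k"])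
  have lim: "(\<lambda>k. d k b) \<longlonglongrightarrow> f (S b)" if b: "b \<in> space M" for b
  proof (rule LIMSEQ_I)
    fix r :: real assume r: "0 < r"
    obtain \<delta> where \<delta>: "0 < \<delta>" "\<And>y. dist y (S b) < \<delta> \<Longrightarrow> dist (f y) (f (S b)) < r / 2"
      using f(1)[unfolded continuous_on_iff, rule_format, of "S b" "r/2"] r by auto
    obtain \<eta> where \<eta>: "0 < \<eta>" "\<And>y. \<delta> \<le> dist y (S b) \<Longrightarrow> h n y + G n b + \<eta> \<le> (dist y (X n b))\<^sup>2"
      using gap[OF b \<delta>(1)] by blast
    obtain N where N: "\<And>k. k \<ge> N \<Longrightarrow> t k < \<eta>"
      using LIMSEQ_D[OF t_lim \<eta>(1)] t by (auto simp: abs_of_pos)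
    have "norm (d k b - f (S b)) < r" if "k \<ge> N" for k
    proof -
      \<comment> \<open>Near \<open>S b\<close> continuity controls \<open>f y\<close>; away from it
        the gap \<open>\<eta>\<close> exceeds the whole perturbation
        \<open>t k * f y\<close>.\<close>
      have "G n b - t k * (f (S b) + r / 2) \<le> (dist (X n b) y)\<^sup>2 - (h n y + t k * f y)" for y
      proof (cases "dist y (S b) < \<delta>")
        case True
        then have "f y \<le> f (S b) + r / 2" using \<delta>(2)[OF True] unfolding dist_real_def by linarith
        then have "t k * f y \<le> t k * (f (S b) + r / 2)" using t[of k] by simp
        then show ?thesis using h_le[OF nn b, of y] by (simp add: dist_commute)
      next
        case False
        have "0 \<le> t k * (f (S b) + r / 2)" using t[of k] f(2)[of "S b"] r by simp
        then show ?thesis using \<eta>(2)[of y] False N[OF that] tf(2)[of k y] by (simp add: dist_commute)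
      qed
      then have "ereal (G n b - t k * (f (S b) + r / 2)) \<le> E n (\<lambda>y. t k * f y) (X n b)"
        unfolding E_def by (intro INF_greatest) simp
      then have "G n b - t k * (f (S b) + r / 2) \<le> e n (\<lambda>y. t k * f y) b"
        using e_bounds(1)[of n b "\<lambda>y. t k * f y", OF nn b tf(2)] by (cases "E n (\<lambda>y. t k * f y) (X n b)") auto
      then have "d k b \<le> f (S b) + r / 2"
        using t[of k] by (simp add: d_def field_simps)
      then show ?thesis using d_lower[OF b, of k] r by simp
    qed
    then show "\<exists>no. \<forall>k\<ge>no. norm (d k b - f (S b)) < r" by blast
  qed
  have "(\<lambda>k. integral\<^sup>L M (d k)) \<longlonglongrightarrow> (\<integral>b. f (S b) \<partial>M)"
  proof (rule integral_dominated_convergence[where w="\<lambda>_. 1"])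
    show "d k \<in> borel_measurable M" for k
      unfolding d_def using int_e[of k] G_integrable[OF nn] by (intro borel_measurable_divide borel_measurable_diff) auto
    show "AE b in M. norm (d k b) \<le> 1" for k
    proof (rule AE_I2)
      fix b assume b: "b \<in> space M"
      show "norm (d k b) \<le> 1"
        using f(2)[of "S b"] d_lower[OF b, of k] d_upper[OF b, of k] by simp
    qed
  qed (use lim in auto)
  then have "integral\<^sup>L \<nu> f \<le> (\<integral>b. f (S b) \<partial>M)"
    by (rule LIMSEQ_le_const) (use le in blast)
  also have "\<dots> = integral\<^sup>L (distr M borel S) f"
    by (subst integral_distr) auto
  finally show "integral\<^sup>L \<nu> f \<le> integral\<^sup>L (distr M borel S) f" .
qed (use \<nu> S_moment in \<open>auto simp: P2_def\<close>)

end

section \<open>Gradients of convex functions\<close>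

text \<open>The relation \<open>Y = \<nabla>\<phi> \<circ> X\<close> on \<open>A\<close>. The
  subgradient inequality is required only between points of the image of \<open>X\<close>, so
  \<open>\<phi>\<close> may be arbitrary far from it.\<close>

definition gradient_along :: "'a set \<Rightarrow> ('a \<Rightarrow> 'b::euclidean_space) \<Rightarrow> ('a \<Rightarrow> 'b) \<Rightarrow> ('b \<Rightarrow> real) \<Rightarrow> bool"
  where "gradient_along A X Y \<phi> \<longleftrightarrow>
    (\<forall>a\<in>A. (\<forall>b\<in>A. \<phi> (X a) + Y a \<bullet> (X b - X a) \<le> \<phi> (X b)) \<and> (GDERIV \<phi> (X a) :> Y a))"

text \<open>Provides the potential of the diagonal term in the weighted sum over all
  indices.\<close>

lemma gradient_along_self: "gradient_along A X X (\<lambda>x. (x \<bullet> x) / 2)"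
proof -
  have "(x \<bullet> x) / 2 + x \<bullet> (y - x) \<le> (y \<bullet> y) / 2" for x y :: 'b
    using inner_ge_zero[of "y - x"] by (simp add: inner_diff_left inner_diff_right inner_commute)
  moreover have "GDERIV (\<lambda>x. (x \<bullet> x) / 2) x :> x" for x :: 'b
    unfolding gderiv_def by (auto intro!: derivative_eq_intros simp: inner_commute)
  ultimately show ?thesis by (simp add: gradient_along_def)
qed

text \<open>This lets a weighted mean of maps take the place of a single map in the
  iteration.\<close>

lemma gradient_along_sum:
  assumes "finite J" "\<And>j. j \<in> J \<Longrightarrow> 0 \<le> c j" "\<And>j. j \<in> J \<Longrightarrow> gradient_along A X (Y j) (\<phi> j)"
  shows "gradient_along A X (\<lambda>a. \<Sum>j\<in>J. c j *\<^sub>R Y j a) (\<lambda>x. \<Sum>j\<in>J. c j * \<phi> j x)"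
  unfolding gradient_along_def
proof (intro ballI conjI)
  fix a b assume ab: "a \<in> A" "b \<in> A"
  have "(\<Sum>j\<in>J. c j * (\<phi> j (X a) + Y j a \<bullet> (X b - X a))) \<le> (\<Sum>j\<in>J. c j * \<phi> j (X b))"
    using assms ab by (intro sum_mono mult_left_mono) (auto simp: gradient_along_def)
  then show "(\<Sum>j\<in>J. c j * \<phi> j (X a)) + (\<Sum>j\<in>J. c j *\<^sub>R Y j a) \<bullet> (X b - X a) \<le> (\<Sum>j\<in>J. c j * \<phi> j (X b))"
    by (simp add: distrib_left sum.distrib inner_sum_left)
next
  fix a assume a: "a \<in> A"
  have "((\<lambda>x. \<Sum>j\<in>J. c j * \<phi> j x) has_derivative (\<lambda>h. \<Sum>j\<in>J. c j * (h \<bullet> Y j a))) (at (X a))"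
    using assms(3) a
    by (intro has_derivative_sum has_derivative_mult_right) (auto simp: gradient_along_def gderiv_def)
  then show "GDERIV (\<lambda>x. \<Sum>j\<in>J. c j * \<phi> j x) (X a) :> (\<Sum>j\<in>J. c j *\<^sub>R Y j a)"
    by (simp add: gderiv_def inner_sum_right)
qed

text \<open>Convexity bounds the difference quotients along the segment from \<open>x\<close> to
  \<open>z\<close> by \<open>f z - f x\<close>; the inequality is their limit as the step tends to 0
  from the right.\<close>

lemma GCF_gradient:
  assumes "T \<in> GCF \<Omega>"
  obtains f where "\<And>x. x \<in> \<Omega> \<Longrightarrow> GDERIV f x :> T x"
    and "\<And>x z. x \<in> \<Omega> \<Longrightarrow> z \<in> \<Omega> \<Longrightarrow> f x + T x \<bullet> (z - x) \<le> f z"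
proof -
  obtain \<phi> where \<phi>: "proper_convex_lsc \<phi>"
    and fin: "\<And>x. x \<in> \<Omega> \<Longrightarrow> \<bar>\<phi> x\<bar> \<noteq> \<infinity>"
    and grad: "\<And>x. x \<in> \<Omega> \<Longrightarrow> GDERIV (\<lambda>y. real_of_ereal (\<phi> y)) x :> T x"
    using assms unfolding GCF_def mem_Collect_eq by metis
  let ?f = "\<lambda>y. real_of_ereal (\<phi> y)"
  have sub: "?f x + T x \<bullet> (z - x) \<le> ?f z" if xz: "x \<in> \<Omega>" "z \<in> \<Omega>" for x z
  proof -
    obtain p q where pq: "\<phi> x = ereal p" "\<phi> z = ereal q" using fin xz by fastforce
    have chord: "(?f (x + t *\<^sub>R (z - x)) - ?f x) / t \<le> ?f z - ?f x" if t: "0 < t" "t < 1" for t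
    proof -
      have "\<phi> ((1 - t) *\<^sub>R x + t *\<^sub>R z) \<le> ereal (1 - t) * \<phi> x + ereal t * \<phi> z"
        using \<phi> t by (auto simp: proper_convex_lsc_def)
      then have "\<phi> (x + t *\<^sub>R (z - x)) \<le> ereal ((1 - t) * p + t * q)"
        by (simp add: pq algebra_simps)
      \<comment> \<open>The segment may leave \<open>\<Omega>\<close>, but finite endpoint values
        exclude \<open>\<infinity>\<close> on it and properness excludes
        \<open>-\<infinity>\<close>.\<close>
      moreover have "\<phi> (x + t *\<^sub>R (z - x)) \<noteq> - \<infinity>" using \<phi> by (auto simp: proper_convex_lsc_def)
      ultimately have "?f (x + t *\<^sub>R (z - x)) \<le> (1 - t) * p + t * q"
        by (cases "\<phi> (x + t *\<^sub>R (z - x))") auto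
      then show ?thesis using t by (simp add: pq field_simps)
    qed
    have "((\<lambda>t. ?f (x + t *\<^sub>R (z - x))) has_derivative (\<lambda>t. (t *\<^sub>R (z - x)) \<bullet> T x)) (at 0)"
      by (rule has_derivative_compose[where g="?f"])
        (use grad[OF xz(1)] in \<open>auto intro!: derivative_eq_intros simp: gderiv_def\<close>)
    then have "((\<lambda>t. ?f (x + t *\<^sub>R (z - x))) has_real_derivative (z - x) \<bullet> T x) (at 0)"
      by (simp add: has_field_derivative_def mult.commute[of _ "(z - x) \<bullet> T x"] mult_commute_abs)
    then have "((\<lambda>t. (?f (x + t *\<^sub>R (z - x)) - ?f x) / t) \<longlongrightarrow> (z - x) \<bullet> T x) (at_right 0)"
      by (simp add: DERIV_def filterlim_at_split)
    moreover have "eventually (\<lambda>t. (?f (x + t *\<^sub>R (z - x)) - ?f x) / t \<le> ?f z - ?f x) (at_right 0)"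
      unfolding eventually_at_right_field by (intro exI[of _ 1] conjI allI impI chord) auto
    ultimately have "(z - x) \<bullet> T x \<le> ?f z - ?f x"
      by (rule tendsto_upperbound) simp
    then show ?thesis by (simp add: inner_commute)
  qed
  show ?thesis by (rule that[of ?f]) (use grad sub in auto)
qed

text \<open>Partial derivatives are limits of difference quotients. Extending \<open>f\<close> by
  zero makes the quotients Borel everywhere, and openness of \<open>\<Omega>\<close> makes the
  extension harmless in the limit.\<close>

lemma gradient_measurable:
  fixes f :: "'a::euclidean_space \<Rightarrow> real"
  assumes \<Omega>: "open \<Omega>" and grad: "\<And>x. x \<in> \<Omega> \<Longrightarrow> GDERIV f x :> T x"
  shows "T \<in> borel_measurable (restrict_space borel \<Omega>)"
proof (rule borel_measurable_euclidean_space[THEN iffD2], rule ballI)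
  fix i :: 'a assume i: "i \<in> Basis"
  define f' where "f' = (\<lambda>x. indicator \<Omega> x *\<^sub>R f x)"
  have "continuous_on \<Omega> f"
    using grad by (auto intro!: continuous_at_imp_continuous_on has_derivative_continuous simp: gderiv_def)
  then have [measurable]: "f' \<in> borel_measurable borel"
    unfolding f'_def using \<Omega> by (intro borel_measurable_continuous_on_indicator) auto
  define r where "r n = 1 / real (Suc n)" for n
  have r: "r \<longlonglongrightarrow> 0" "\<And>n. r n \<noteq> 0"
    unfolding r_def by (rule LIMSEQ_Suc[OF lim_1_over_n]) simp
  show "(\<lambda>x. T x \<bullet> i) \<in> borel_measurable (restrict_space borel \<Omega>)"
  proof (rule borel_measurable_LIMSEQ_real)
    fix x assume "x \<in> space (restrict_space borel \<Omega>)"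
    then have x: "x \<in> \<Omega>" by (simp add: space_restrict_space)
    have lim: "(\<lambda>n. x + r n *\<^sub>R i) \<longlonglongrightarrow> x"
      using tendsto_add[OF tendsto_const tendsto_scaleR[OF r(1) tendsto_const], of x i] by simp
    have "((\<lambda>t. f (x + t *\<^sub>R i)) has_derivative (\<lambda>t. (t *\<^sub>R i) \<bullet> T x)) (at 0)"
      by (rule has_derivative_compose[where g=f])
        (use grad[OF x] in \<open>auto intro!: derivative_eq_intros simp: gderiv_def\<close>)
    then have "((\<lambda>t. f (x + t *\<^sub>R i)) has_real_derivative i \<bullet> T x) (at 0)"
      by (simp add: has_field_derivative_def mult_commute_abs)
    then have "((\<lambda>t. (f (x + t *\<^sub>R i) - f x) / t) \<longlongrightarrow> i \<bullet> T x) (at 0)"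
      by (simp add: DERIV_def)
    moreover have "filterlim r (at 0) sequentially"
      using r by (simp add: filterlim_at)
    ultimately have "(\<lambda>n. (f (x + r n *\<^sub>R i) - f x) / r n) \<longlonglongrightarrow> i \<bullet> T x"
      by (rule filterlim_compose)
    moreover have "eventually (\<lambda>n. (f' (x + r n *\<^sub>R i) - f' x) / r n = (f (x + r n *\<^sub>R i) - f x) / r n) sequentially"
      using topological_tendstoD[OF lim \<Omega> x] by eventually_elim (simp add: f'_def x)
    ultimately show "(\<lambda>n. (f' (x + r n *\<^sub>R i) - f' x) / r n) \<longlonglongrightarrow> T x \<bullet> i"
      unfolding inner_commute[of "T x" i] using tendsto_cong by fast
  next
    show "(\<lambda>x. (f' (x + r n *\<^sub>R i) - f' x) / r n) \<in> borel_measurable (restrict_space borel \<Omega>)" for n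
      by (rule measurable_restrict_space1) measurable
  qed
qed

lemma GCF_measurable:
  assumes "open \<Omega>" "T \<in> GCF \<Omega>"
  shows "T \<in> borel_measurable (restrict_space borel \<Omega>)"
  using GCF_gradient[OF assms(2)] gradient_measurable[OF assms(1)] by metis

section \<open>Barycenters of gradient families\<close>

lemma sum_list_weighted_family: "(\<Sum>(m, w)\<leftarrow>weighted_family m w n. F m w) = (\<Sum>j=1..n. F (m j) (w j))"
  by (simp add: weighted_family_def comp_def interv_sum_list_conv_sum_set_nat atLeastLessThanSuc_atLeastAtMost del: upt_Suc)

lemma is_barycenter_scale:
  assumes "0 < c"
  shows "is_barycenter (weighted_family m (\<lambda>j. c * w j) n) \<nu> = is_barycenter (weighted_family m w n) \<nu>"
  using assms by (simp add: is_barycenter_def sum_list_weighted_family mult.assoc sum_distrib_left[symmetric])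

text \<open>The pairwise potentials yield an instance of \<open>barycenter_dual\<close>; openness of
  the last image yields the gap that \<open>minimizer_unique\<close> asks for.\<close>

lemma barycenter_normalized:
  fixes X :: "nat \<Rightarrow> 'a \<Rightarrow> 'b::euclidean_space"
  assumes M: "prob_space M" and n: "n \<ge> 1"
    and w_pos: "\<And>j. j \<in> {1..n} \<Longrightarrow> 0 < w j" and w_sum: "(\<Sum>j=1..n. w j) = 1"
    and X_meas: "\<And>j. j \<in> {1..n} \<Longrightarrow> X j \<in> borel_measurable M"
    and X_sq: "\<And>j. j \<in> {1..n} \<Longrightarrow> integrable M (\<lambda>a. (norm (X j a))\<^sup>2)"
    and \<nu>: "\<And>j. j \<in> {1..n} \<Longrightarrow> \<nu> j = distr M borel (X j)"
    and pot: "\<And>i j. i \<in> {1..n} \<Longrightarrow> j \<in> {1..n} \<Longrightarrow> i < j \<Longrightarrow> gradient_along (space M) (X j) (X i) (\<phi> i j)"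
    and image_open: "open (X n ` space M)"
  shows "is_barycenter (weighted_family \<nu> w n) \<rho> \<longleftrightarrow> \<rho> = distr M borel (\<lambda>a. \<Sum>j=1..n. w j *\<^sub>R X j a)"
proof -
  text \<open>For each pair the larger index gets the potential and the smaller one its conjugate, so that
    only differentiable functions enter \<open>K n\<close>.\<close>
  define r where "r i j a = (if i = j then (X i a \<bullet> X i a) / 2 else if j < i then \<phi> j i (X i a)
    else X i a \<bullet> X j a - \<phi> i j (X j a))" for i j a
  have r_le: "X i a \<bullet> X j b \<le> r i j a + r j i b"
    if ij: "i \<in> {1..n}" "j \<in> {1..n}" and ab: "a \<in> space M" "b \<in> space M" for i j a b
  proof (cases i j rule: linorder_cases)
    case less
    have "\<phi> i j (X j a) + X i a \<bullet> (X j b - X j a) \<le> \<phi> i j (X j b)"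
      using pot[OF ij less] ab by (auto simp: gradient_along_def)
    then show ?thesis using less by (simp add: r_def inner_diff_right)
  next
    case equal
    then show ?thesis using inner_ge_zero[of "X i a - X j b"]
      by (simp add: r_def inner_diff_left inner_diff_right inner_commute)
  next
    case greater
    have "\<phi> j i (X i b) + X j b \<bullet> (X i a - X i b) \<le> \<phi> j i (X i a)"
      using pot[OF ij(2,1) greater] ab by (auto simp: gradient_along_def)
    then show ?thesis using greater by (simp add: r_def inner_diff_right inner_commute)
  qed
  have r_eq: "X i a \<bullet> X j a = r i j a + r j i a" for i j a
    by (cases i j rule: linorder_cases) (simp_all add: r_def inner_commute)
  \<comment> \<open>\<open>K i\<close> collects the shares of all products
    \<open>x\<^sub>i \<bullet> x\<^sub>j\<close> charged to index \<open>i\<close>, so the weighted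
    sum of the \<open>K i\<close> dominates \<open>|\<Sum> w\<^sub>i x\<^sub>i|\<^sup>2\<close>,
    with equality on the diagonal.\<close>
  define K where "K i a = 2 * (\<Sum>j=1..n. w j * r i j a)" for i a
  define G where "G i a = X i a \<bullet> X i a - K i a" for i a
  have square: "(\<Sum>i=1..n. w i *\<^sub>R x i) \<bullet> (\<Sum>i=1..n. w i *\<^sub>R x i) =
      (\<Sum>i=1..n. \<Sum>j=1..n. w i * w j * (x i \<bullet> x j))" for x :: "nat \<Rightarrow> 'b"
    by (subst sum.swap) (simp add: inner_sum_left inner_sum_right sum_distrib_left mult_ac inner_commute)
  have sum_K: "(\<Sum>i=1..n. \<Sum>j=1..n. w i * w j * (r i j (a i) + r j i (a j))) = (\<Sum>i=1..n. w i * K i (a i))" for a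
  proof -
    have "(\<Sum>i=1..n. \<Sum>j=1..n. w i * w j * r j i (a j)) = (\<Sum>i=1..n. \<Sum>j=1..n. w i * w j * r i j (a i))"
      by (subst sum.swap) (simp add: mult_ac)
    then have "(\<Sum>i=1..n. \<Sum>j=1..n. w i * w j * (r i j (a i) + r j i (a j))) =
        2 * (\<Sum>i=1..n. \<Sum>j=1..n. w i * w j * r i j (a i))"
      by (simp add: distrib_left sum.distrib)
    also have "\<dots> = (\<Sum>i=1..n. w i * K i (a i))"
      by (simp add: K_def sum_distrib_left mult_ac)
    finally show ?thesis .
  qed
  have expand: "(\<Sum>j=1..n. w j * (dist y (x j))\<^sup>2) =
      y \<bullet> y - 2 * (y \<bullet> (\<Sum>j=1..n. w j *\<^sub>R x j)) + (\<Sum>j=1..n. w j * (x j \<bullet> x j))" for y :: 'b and x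
  proof -
    have "w j * (dist y (x j))\<^sup>2 = w j * (y \<bullet> y) - 2 * (w j * (y \<bullet> x j)) + w j * (x j \<bullet> x j)" for j
      by (simp add: dist_norm power2_norm_eq_inner inner_diff_left inner_diff_right inner_commute right_diff_distrib distrib_left)
    then have "(\<Sum>j=1..n. w j * (dist y (x j))\<^sup>2) =
        (\<Sum>j=1..n. w j) * (y \<bullet> y) - 2 * (\<Sum>j=1..n. w j * (y \<bullet> x j)) + (\<Sum>j=1..n. w j * (x j \<bullet> x j))"
      by (simp add: sum.distrib sum_subtractf sum_distrib_left sum_distrib_right)
    then show ?thesis by (simp add: w_sum[simplified] inner_sum_right)
  qed
  interpret M: prob_space M by fact
  interpret B: barycenter_dual M n w X G
  proof
    fix y and a :: "nat \<Rightarrow> 'a" assume a: "\<And>j. j \<in> {1..n} \<Longrightarrow> a j \<in> space M"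
    let ?s = "\<Sum>j=1..n. w j *\<^sub>R X j (a j)"
    have "?s \<bullet> ?s \<le> (\<Sum>i=1..n. w i * K i (a i))"
      unfolding square sum_K[symmetric] using r_le a w_pos
      by (intro sum_mono mult_left_mono) (auto simp: less_imp_le)
    \<comment> \<open>Completing the square in \<open>y\<close> reduces the claim to the bound on
      \<open>?s \<bullet> ?s\<close>.\<close>
    moreover have "0 \<le> (y - ?s) \<bullet> (y - ?s)" by simp
    then have "0 \<le> y \<bullet> y - 2 * (y \<bullet> ?s) + ?s \<bullet> ?s"
      by (simp only: inner_diff_left inner_diff_right inner_commute[of ?s y])
    ultimately show "(\<Sum>j=1..n. w j * G j (a j)) \<le> (\<Sum>j=1..n. w j * (dist y (X j (a j)))\<^sup>2)"
      unfolding expand G_def right_diff_distrib sum_subtractf by linarith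
  next
    fix b assume b: "b \<in> space M"
    let ?s = "\<Sum>j=1..n. w j *\<^sub>R X j b"
    have "?s \<bullet> ?s = (\<Sum>i=1..n. w i * K i b)"
      unfolding square sum_K[of "\<lambda>_. b", symmetric] by (simp add: r_eq)
    then show "(\<Sum>j=1..n. w j * (dist ?s (X j b))\<^sup>2) \<le> (\<Sum>j=1..n. w j * G j b)"
      unfolding expand G_def right_diff_distrib sum_subtractf by linarith
  qed (use n w_pos w_sum X_meas X_sq in auto)
  \<comment> \<open>As \<open>n\<close> is the largest index, every share in \<open>K n\<close>
    depends on \<open>b\<close> only through \<open>X n b\<close>.\<close>
  define \<Phi> where "\<Phi> j = (if j = n then (\<lambda>x. (x \<bullet> x) / 2) else \<phi> j n)" for j
  define \<psi> where "\<psi> x = (\<Sum>j=1..n. w j * \<Phi> j x)" for x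
  have K_\<psi>: "K n b = 2 * \<psi> (X n b)" for b
    unfolding K_def \<psi>_def by (auto intro!: sum.cong simp: r_def \<Phi>_def)
  have "gradient_along (space M) (X n) B.S \<psi>"
    unfolding B.S_def[abs_def] \<psi>_def[abs_def]
  proof (rule gradient_along_sum)
    show "gradient_along (space M) (X n) (X j) (\<Phi> j)" if "j \<in> {1..n}" for j
      using that pot[of j n] n gradient_along_self[of "space M" "X n"] by (cases "j = n") (auto simp: \<Phi>_def)
  qed (use w_pos in \<open>auto simp: less_imp_le\<close>)
  then have \<psi>_grad: "GDERIV \<psi> (X n b) :> B.S b" if "b \<in> space M" for b
    using that by (auto simp: gradient_along_def)
  \<comment> \<open>Instead of \<open>b\<close>, \<open>h_le\<close> is used at a \<open>b'\<close>
    with \<open>X n b'\<close> shifted from \<open>X n b\<close> by \<open>\<rho>\<close> in the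
    direction of \<open>y - S b\<close>. The first-order gain is at least
    \<open>2 * \<rho> * \<delta>\<close> and the error at most \<open>\<rho> * \<delta>\<close>;
    \<open>\<rho>\<close> does not depend on \<open>y\<close>.\<close>
  have gap: "\<exists>\<eta>>0. \<forall>y. \<delta> \<le> dist y (B.S b) \<longrightarrow> B.h n y + G n b + \<eta> \<le> (dist y (X n b))\<^sup>2"
    if b: "b \<in> space M" and \<delta>: "0 < \<delta>" for b \<delta>
  proof -
    let ?x = "X n b"
    obtain d where d: "0 < d"
      "\<And>x. norm (x - ?x) < d \<Longrightarrow> norm (\<psi> x - \<psi> ?x - (x - ?x) \<bullet> B.S b) \<le> \<delta> / 2 * norm (x - ?x)"
      using \<psi>_grad[OF b] \<delta> unfolding gderiv_def has_derivative_at_alt by (meson half_gt_zero)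
    \<comment> \<open>Openness guarantees that the shifted point is again of the form
      \<open>X n b'\<close>.\<close>
    obtain d' where d': "0 < d'" "ball ?x d' \<subseteq> X n ` space M"
      using image_open b by (meson imageI open_contains_ball)
    define \<rho> where "\<rho> = min d d' / 2"
    have \<rho>: "0 < \<rho>" "\<rho> < d" "\<rho> < d'" using d d' by (auto simp: \<rho>_def)
    have "B.h n y + G n b + \<rho> * \<delta> \<le> (dist y ?x)\<^sup>2" if y: "\<delta> \<le> dist y (B.S b)" for y
    proof -
      define v where "v = y - B.S b"
      have v: "\<delta> \<le> norm v" using y by (simp add: v_def dist_norm)
      define u where "u = (\<rho> / norm v) *\<^sub>R v"
      have u: "norm u = \<rho>" "v \<bullet> u = \<rho> * norm v"
        using v \<delta> \<rho> by (auto simp: u_def dot_square_norm power2_eq_square)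
      have "?x + u \<in> ball ?x d'" using u \<rho> by (simp add: dist_norm)
      then obtain b' where b': "b' \<in> space M" "X n b' = ?x + u" using d'(2) by (metis imageE subsetD)
      have "\<psi> (?x + u) - \<psi> ?x - u \<bullet> B.S b \<le> \<delta> / 2 * \<rho>"
        using d(2)[of "?x + u"] u(1) \<rho> by (simp only: add_diff_cancel_left' real_norm_def abs_le_iff)
      moreover have "\<rho> * \<delta> \<le> v \<bullet> u" using u v \<rho> by simp
      moreover have "v \<bullet> u = y \<bullet> u - u \<bullet> B.S b" by (simp add: v_def inner_diff_left inner_diff_right inner_commute)
      moreover have "B.h n y + G n b' \<le> (dist y (?x + u))\<^sup>2"
        using B.h_le[of n b' y] n b' by simp
      moreover have "G n b' = (?x + u) \<bullet> (?x + u) - 2 * \<psi> (?x + u)" "G n b = ?x \<bullet> ?x - 2 * \<psi> ?x"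
        by (simp_all add: G_def K_\<psi> b')
      moreover have "(dist y (?x + u))\<^sup>2 - (?x + u) \<bullet> (?x + u) = (dist y ?x)\<^sup>2 - ?x \<bullet> ?x - 2 * (y \<bullet> u)"
        by (simp add: dist_norm power2_norm_eq_inner inner_diff_left inner_diff_right inner_add_left inner_add_right
            inner_commute)
      moreover have "\<delta> / 2 * \<rho> = \<rho> * \<delta> / 2" by simp
      ultimately show ?thesis by linarith
    qed
    then show ?thesis using \<rho> \<delta> by (intro exI[of _ "\<rho> * \<delta>"]) auto
  qed
  have cost: "(\<Sum>(m, w)\<leftarrow>weighted_family \<nu> w n. w * (W2 \<rho>' m)\<^sup>2) = B.cost \<rho>'" for \<rho>'
    using \<nu> by (auto simp: sum_list_weighted_family B.cost_def intro!: sum.cong)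
  have "is_barycenter (weighted_family \<nu> w n) \<rho> \<longleftrightarrow> \<rho> \<in> P2 UNIV \<and> (\<forall>\<rho>'\<in>P2 UNIV. B.cost \<rho> \<le> B.cost \<rho>')"
    by (simp add: is_barycenter_def cost)
  also have "\<dots> \<longleftrightarrow> \<rho> = distr M borel B.S"
  proof
    assume "\<rho> \<in> P2 UNIV \<and> (\<forall>\<rho>'\<in>P2 UNIV. B.cost \<rho> \<le> B.cost \<rho>')"
    then have "\<rho> \<in> P2 UNIV" "B.cost \<rho> \<le> B.val"
      using B.S_moment B.cost_S by (auto intro: order.trans)
    then show "\<rho> = distr M borel B.S" using gap by (rule B.minimizer_unique)
  next
    assume "\<rho> = distr M borel B.S"
    then show "\<rho> \<in> P2 UNIV \<and> (\<forall>\<rho>'\<in>P2 UNIV. B.cost \<rho> \<le> B.cost \<rho>')"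
      using B.S_moment B.cost_S B.cost_ge by (auto intro: order.trans)
  qed
  finally show ?thesis by (simp add: B.S_def[abs_def])
qed

text \<open>Rescaling the weights does not change the minimizers. Potentials are asked for only
  along the map of larger index, and an open image only of the last one, so a mean with unknown
  image can come first.\<close>

lemma barycenter_gradient_family:
  fixes X :: "nat \<Rightarrow> 'a \<Rightarrow> 'b::euclidean_space"
  assumes M: "prob_space M" and n: "n \<ge> 1"
    and w_pos: "\<And>j. j \<in> {1..n} \<Longrightarrow> 0 < w j"
    and X_meas: "\<And>j. j \<in> {1..n} \<Longrightarrow> X j \<in> borel_measurable M"
    and X_sq: "\<And>j. j \<in> {1..n} \<Longrightarrow> integrable M (\<lambda>a. (norm (X j a))\<^sup>2)"
    and \<nu>: "\<And>j. j \<in> {1..n} \<Longrightarrow> \<nu> j = distr M borel (X j)"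
    and pot: "\<And>i j. i \<in> {1..n} \<Longrightarrow> j \<in> {1..n} \<Longrightarrow> i < j \<Longrightarrow> \<exists>\<phi>. gradient_along (space M) (X j) (X i) \<phi>"
    and image_open: "open (X n ` space M)"
  shows "is_barycenter (weighted_family \<nu> w n) \<rho> \<longleftrightarrow>
    \<rho> = distr M borel (\<lambda>a. \<Sum>j=1..n. (w j / (\<Sum>i=1..n. w i)) *\<^sub>R X j a)"
proof -
  define W where "W = (\<Sum>i=1..n. w i)"
  have W: "0 < W" unfolding W_def using n w_pos by (intro sum_pos) auto
  obtain \<phi> where \<phi>: "\<And>i j. i \<in> {1..n} \<Longrightarrow> j \<in> {1..n} \<Longrightarrow> i < j \<Longrightarrow>
      gradient_along (space M) (X j) (X i) (\<phi> i j)"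
    using pot by metis
  have "is_barycenter (weighted_family \<nu> w n) \<rho> \<longleftrightarrow> is_barycenter (weighted_family \<nu> (\<lambda>j. 1 / W * w j) n) \<rho>"
    using W by (intro is_barycenter_scale[symmetric]) simp
  also have "\<dots> \<longleftrightarrow> \<rho> = distr M borel (\<lambda>a. \<Sum>j=1..n. (1 / W * w j) *\<^sub>R X j a)"
  proof (rule barycenter_normalized[where w="\<lambda>j. 1 / W * w j" and \<phi>=\<phi>, OF M n _ _ X_meas X_sq \<nu> \<phi> image_open])
    show "(\<Sum>j=1..n. 1 / W * w j) = 1"
      unfolding sum_distrib_left[symmetric] using W by (simp add: W_def)
  qed (use W w_pos in auto)
  finally show ?thesis by (simp add: W_def)
qed

theorem theorem4p2:
  fixes \<Omega> :: "(real ^ 'n) set"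
    and I :: "'i set" and T :: "'i \<Rightarrow> real ^ 'n \<Rightarrow> real ^ 'n"
    and \<mu> :: "(real ^ 'n) measure" and m :: "nat \<Rightarrow> (real ^ 'n) measure"
    and J :: nat and s :: "nat \<Rightarrow> 'i" and w :: "nat \<Rightarrow> real"
  assumes "open \<Omega>" and "connected \<Omega>" and "\<Omega> \<noteq> {}"
    and "admissible_family \<Omega> I T"
    and "\<mu> \<in> P2 \<Omega>" and "absolutely_continuous lborel \<mu>"
    and "\<And>j. j \<in> {1..J} \<Longrightarrow> s j \<in> I"
    and "\<And>j. j \<in> {1..J} \<Longrightarrow> m j = push_forward \<Omega> (T (s j)) \<mu>"
    and "\<And>j. j \<in> {1..J} \<Longrightarrow> m j \<in> P2 \<Omega>"
    and "\<And>j. j \<in> {1..J} \<Longrightarrow> 0 < w j"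
    and "(\<Sum>j=1..J. w j) = 1"
  shows
    "\<comment> \<open>the barycenters denoted by \<open>IB\<close> and \<open>Bar\<close> are well defined\<close>
     (\<forall>k\<in>{1..<J}. \<exists>!\<nu>. is_barycenter
        [(IB (weighted_family m w k), \<Sum>j=1..k. w j), (m (Suc k), w (Suc k))] \<nu>) \<and>
     (\<exists>!\<nu>. is_barycenter (weighted_family m w J) \<nu>) \<and>
     IB (weighted_family m w J) =
       push_forward \<Omega> (\<lambda>x. \<Sum>j=1..J. w j *\<^sub>R T (s j) x) \<mu> \<and>
     IB (weighted_family m w J) = Bar (weighted_family m w J)"
proof -
  note \<Omega> = assms(1) and adm = assms(4) and \<mu> = assms(5) and s_I = assms(7) and m_push = assms(8)
    and m_P2 = assms(9) and w_pos = assms(10) and w_sum = assms(11)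
  define M where "M = restrict_space \<mu> \<Omega>"
  have sets_\<mu>: "sets \<mu> = sets borel" and space_\<mu>: "space \<mu> = UNIV"
    using \<mu> sets_eq_imp_space_eq[of \<mu> borel] by (auto simp: P2_def)
  interpret \<mu>: prob_space \<mu> using \<mu> by (simp add: P2_def)
  have space_M: "space M = \<Omega>" by (simp add: M_def space_restrict_space space_\<mu>)
  have sets_M: "sets M = sets (restrict_space borel \<Omega>)"
    by (simp add: M_def sets_restrict_space sets_\<mu>)
  have M: "prob_space M"
    unfolding M_def
  proof (rule prob_space_restrict_space)
    show \<Omega>_sets: "\<Omega> \<in> sets \<mu>" using \<Omega> by (simp add: sets_\<mu>)
    show "emeasure \<mu> \<Omega> = 1"
      using \<mu> \<Omega>_sets by (intro \<mu>.emeasure_eq_1_AE) (auto simp: P2_def)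
  qed
  obtain i0 where i0: "i0 \<in> I" "\<And>x. x \<in> \<Omega> \<Longrightarrow> T i0 x = x"
    and bij: "\<And>i. i \<in> I \<Longrightarrow> bij_betw (T i) \<Omega> \<Omega>"
    and GCF: "\<And>i j. i \<in> I \<Longrightarrow> j \<in> I \<Longrightarrow> T i \<circ> inv_into \<Omega> (T j) \<in> GCF \<Omega>"
    using adm unfolding admissible_family_def by metis
  have inv: "inv_into \<Omega> (T j) (T j x) = x" if "j \<in> I" "x \<in> \<Omega>" for j x
    using bij[OF that(1)] that(2) by (simp add: bij_betw_def)
  have T_in: "T j x \<in> \<Omega>" if "j \<in> I" "x \<in> \<Omega>" for j x
    using bij[OF that(1)] that(2) by (auto simp: bij_betw_def)
  have pot: "\<exists>\<phi>. gradient_along (space M) (T j) (T i) \<phi>" if ij: "i \<in> I" "j \<in> I" for i j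
  proof -
    obtain f where f: "\<And>x. x \<in> \<Omega> \<Longrightarrow> GDERIV f x :> (T i \<circ> inv_into \<Omega> (T j)) x"
      "\<And>x z. x \<in> \<Omega> \<Longrightarrow> z \<in> \<Omega> \<Longrightarrow> f x + (T i \<circ> inv_into \<Omega> (T j)) x \<bullet> (z - x) \<le> f z"
      using GCF_gradient[OF GCF[OF ij]] by blast
    have "gradient_along \<Omega> (T j) (T i) f"
      unfolding gradient_along_def
    proof (intro ballI conjI)
      fix a b assume ab: "a \<in> \<Omega>" "b \<in> \<Omega>"
      show "f (T j a) + T i a \<bullet> (T j b - T j a) \<le> f (T j b)"
        using f(2)[OF T_in[OF ij(2) ab(1)] T_in[OF ij(2) ab(2)]] inv[OF ij(2) ab(1)] by simp
    next
      fix a assume a: "a \<in> \<Omega>"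
      show "GDERIV f (T j a) :> T i a"
        using f(1)[OF T_in[OF ij(2) a]] inv[OF ij(2) a] by simp
    qed
    then show ?thesis by (auto simp: space_M)
  qed
  \<comment> \<open>On \<open>\<Omega>\<close>, \<open>T i\<close> agrees with its composition with
    the inverse of the identity member, which is a gradient and hence measurable.\<close>
  have T_meas: "T i \<in> borel_measurable M" if i: "i \<in> I" for i
  proof -
    have "(T i \<circ> inv_into \<Omega> (T i0)) x = T i x" if "x \<in> space M" for x
      using inv[OF i0(1)] i0(2) that unfolding space_M comp_def by metis
    then have "T i \<in> borel_measurable M \<longleftrightarrow> T i \<circ> inv_into \<Omega> (T i0) \<in> borel_measurable M"
      by (intro measurable_cong) simp
    then show ?thesis
      using GCF_measurable[OF \<Omega> GCF[OF i i0(1)]] unfolding measurable_cong_sets[OF sets_M refl] by blast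
  qed
  define X where "X j = T (s j)" for j
  have X_meas: "X j \<in> borel_measurable M" if "j \<in> {1..J}" for j
    using T_meas s_I that by (simp add: X_def)
  have m_distr: "m j = distr M borel (X j)" if "j \<in> {1..J}" for j
    using m_push[OF that] by (simp add: push_forward_def M_def X_def)
  have X_sq: "integrable M (\<lambda>a. (norm (X j a))\<^sup>2)" if j: "j \<in> {1..J}" for j
    using m_P2[OF j] integrable_distr[OF X_meas[OF j], of "\<lambda>x. (norm x)\<^sup>2"] m_distr[OF j]
    by (simp add: P2_def)
  have X_image: "X j ` space M = \<Omega>" if "j \<in> {1..J}" for j
    using bij[OF s_I[OF that]] by (simp add: X_def space_M bij_betw_def)
  have X_pot: "\<exists>\<phi>. gradient_along (space M) (X j) (X i) \<phi>" if "i \<in> {1..J}" "j \<in> {1..J}" for i j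
    using pot s_I that by (simp add: X_def)
  define \<Lambda> where "\<Lambda> k = (\<Sum>j=1..k. w j)" for k
  have \<Lambda>_pos: "0 < \<Lambda> k" if "k \<in> {1..J}" for k
    unfolding \<Lambda>_def using that w_pos by (intro sum_pos) auto
  \<comment> \<open>The mean of the first \<open>k\<close> maps with normalized weights; for
    \<open>k = J\<close> the normalization is trivial because
    \<open>\<Lambda> J = 1\<close>.\<close>
  define A where "A k = (\<lambda>a. \<Sum>j=1..k. (w j / \<Lambda> k) *\<^sub>R X j a)" for k
  have bar_step: "is_barycenter [(distr M borel (A k), \<Lambda> k), (m (Suc k), w (Suc k))] \<rho> \<longleftrightarrow>
      \<rho> = distr M borel (A (Suc k))" if k: "k \<in> {1..<J}" for k \<rho>
  proof -
    \<comment> \<open>The mean takes index 1 and the new map index 2, so potentials are needed only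
      along \<open>X (Suc k)\<close>, whose image is the open set \<open>\<Omega>\<close>.\<close>
    define Y where "Y j = (if j = 1 then A k else X (Suc k))" for j :: nat
    define u where "u j = (if j = 1 then \<Lambda> k else w (Suc k))" for j :: nat
    have two: "{1..2} = {1, 2::nat}" by auto
    have upt_two: "[1..<Suc 2] = [1, 2]" by (simp add: upt_conv_Cons)
    have kJ: "Suc k \<in> {1..J}" "k \<in> {1..J}" "\<And>j. j \<in> {1..k} \<Longrightarrow> j \<in> {1..J}" using k by auto
    have wf: "weighted_family (\<lambda>j. distr M borel (Y j)) u 2 =
        [(distr M borel (A k), \<Lambda> k), (m (Suc k), w (Suc k))]"
      using m_distr[OF kJ(1)] unfolding weighted_family_def upt_two by (simp add: Y_def u_def)
    have "is_barycenter (weighted_family (\<lambda>j. distr M borel (Y j)) u 2) \<rho> \<longleftrightarrow>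
      \<rho> = distr M borel (\<lambda>a. \<Sum>j=1..2. (u j / (\<Sum>i=1..2. u i)) *\<^sub>R Y j a)"
    proof (rule barycenter_gradient_family[OF M])
      show "0 < u j" for j using \<Lambda>_pos[OF kJ(2)] w_pos[OF kJ(1)] by (simp add: u_def)
      have "A k \<in> borel_measurable M" unfolding A_def using X_meas kJ(3) by auto
      then show "Y j \<in> borel_measurable M" for j using X_meas[OF kJ(1)] by (simp add: Y_def)
      have "integrable M (\<lambda>a. (norm (A k a))\<^sup>2)"
        unfolding A_def using X_meas X_sq kJ(3) by (intro integrable_norm_sq_sum) auto
      then show "integrable M (\<lambda>a. (norm (Y j a))\<^sup>2)" for j using X_sq[OF kJ(1)] by (simp add: Y_def)
      show "open (Y 2 ` space M)" using X_image[OF kJ(1)] \<Omega> by (simp add: Y_def)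
      fix i j :: nat assume "i \<in> {1..2}" "j \<in> {1..2}" "i < j"
      then have ij: "i = 1" "j = 2" by auto
      obtain \<phi> where \<phi>: "\<And>i. i \<in> {1..k} \<Longrightarrow> gradient_along (space M) (X (Suc k)) (X i) (\<phi> i)"
        using X_pot[OF _ kJ(1)] kJ(3) by metis
      have "gradient_along (space M) (X (Suc k)) (A k) (\<lambda>x. \<Sum>j=1..k. (w j / \<Lambda> k) * \<phi> j x)"
        unfolding A_def using \<phi> w_pos kJ(3) \<Lambda>_pos[OF kJ(2)]
        by (intro gradient_along_sum) (auto simp: less_imp_le)
      then show "\<exists>\<phi>. gradient_along (space M) (Y j) (Y i) \<phi>" by (auto simp: Y_def ij)
    qed auto
    moreover have "(\<lambda>a. \<Sum>j=1..2. (u j / (\<Sum>i=1..2. u i)) *\<^sub>R Y j a) = A (Suc k)"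
    proof
      fix a
      have \<Lambda>_Suc: "\<Lambda> (Suc k) = \<Lambda> k + w (Suc k)" by (simp add: \<Lambda>_def)
      have "(\<Sum>j=1..2. (u j / (\<Sum>i=1..2. u i)) *\<^sub>R Y j a) =
          (\<Lambda> k / \<Lambda> (Suc k)) *\<^sub>R A k a + (w (Suc k) / \<Lambda> (Suc k)) *\<^sub>R X (Suc k) a"
        unfolding two by (simp add: u_def Y_def \<Lambda>_Suc)
      also have "(\<Lambda> k / \<Lambda> (Suc k)) *\<^sub>R A k a = (\<Sum>j=1..k. (w j / \<Lambda> (Suc k)) *\<^sub>R X j a)"
        using \<Lambda>_pos[OF kJ(2)] by (simp add: A_def scaleR_sum_right)
      finally show "(\<Sum>j=1..2. (u j / (\<Sum>i=1..2. u i)) *\<^sub>R Y j a) = A (Suc k) a"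
        by (simp add: A_def)
    qed
    ultimately show ?thesis by (simp add: wf)
  qed
  have IB: "IB (weighted_family m w k) = distr M borel (A k)" if "k \<ge> 1" "k \<le> J" for k
    using that
  proof (induction k rule: dec_induct)
    case base
    then show ?case
      using \<Lambda>_pos[of 1] w_pos[of 1] m_distr[of 1] by (simp add: weighted_family_def IB_single A_def \<Lambda>_def)
  next
    case (step k)
    have k: "k \<in> {1..<J}" using step by auto
    have ne: "weighted_family m w k \<noteq> []" using step.hyps by (simp add: weighted_family_def)
    have sum_w: "(\<Sum>(m', w')\<leftarrow>weighted_family m w k. w') = \<Lambda> k"
      unfolding \<Lambda>_def by (rule sum_list_weighted_family)
    have "IB (weighted_family m w (Suc k)) = IB (weighted_family m w k @ [(m (Suc k), w (Suc k))])"
      by (simp add: weighted_family_def)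
    also have "\<dots> = Bar [(IB (weighted_family m w k), \<Lambda> k), (m (Suc k), w (Suc k))]"
      unfolding IB_snoc[OF ne] sum_w ..
    \<comment> \<open>The equivalence in \<open>bar_step\<close> includes uniqueness, which
      evaluates the \<open>THE\<close> in \<open>Bar\<close>.\<close>
    also have "\<dots> = distr M borel (A (Suc k))"
      using step.IH k bar_step[OF k] by (simp add: Bar_def)
    finally show ?case .
  qed
  have J: "J \<ge> 1" using w_sum by (cases J) auto
  have bar: "is_barycenter (weighted_family m w J) \<rho> \<longleftrightarrow> \<rho> = distr M borel (A J)" for \<rho>
    unfolding A_def \<Lambda>_def
    by (rule barycenter_gradient_family[OF M J w_pos X_meas X_sq m_distr X_pot])
      (use X_image[of J] J \<Omega> in auto)
  have push: "distr M borel (A J) = push_forward \<Omega> (\<lambda>x. \<Sum>j=1..J. w j *\<^sub>R T (s j) x) \<mu>"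
    by (simp add: push_forward_def A_def M_def X_def \<Lambda>_def w_sum[simplified])
  show ?thesis
  proof (intro conjI ballI)
    fix k assume k: "k \<in> {1..<J}"
    then have "IB (weighted_family m w k) = distr M borel (A k)" by (intro IB) auto
    then show "\<exists>!\<nu>. is_barycenter
        [(IB (weighted_family m w k), \<Sum>j=1..k. w j), (m (Suc k), w (Suc k))] \<nu>"
      unfolding \<Lambda>_def[symmetric] using bar_step[OF k] by metis
  next
    show "\<exists>!\<nu>. is_barycenter (weighted_family m w J) \<nu>" using bar by metis
    show "IB (weighted_family m w J) = push_forward \<Omega> (\<lambda>x. \<Sum>j=1..J. w j *\<^sub>R T (s j) x) \<mu>"
      using IB[OF J] push by simp
    show "IB (weighted_family m w J) = Bar (weighted_family m w J)"
      using IB[OF J] unfolding Bar_def bar by simp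
  qed
qed

end
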